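(* Let $m,\gamma,k_B,\omega,q_0>0$ and $T_0>T_1>0$ be real constants. Set $\alpha=4q_0\gamma-3\omega^2\gamma m$, $\beta=\omega(2\gamma^2+4q_0m-\omega^2m^2)$, and $$r=\sqrt{\alpha^2+\beta^2},\quad r_2=\sqrt{\Big(\frac{2q_0}{m}-\omega^2\Big)^2+\Big(\frac{\omega\gamma}{m}\Big)^2},\quad \theta=\angle\Big(\frac{2q_0}{m}-\omega^2+i\frac{\omega\gamma}{m}\Big),\quad \phi^*=\angle(\beta-i\alpha),$$ $$\kappa_1=\frac{2m\gamma r_2}{r},\qquad \kappa_2=\frac{2m\gamma q_0\omega}{2\gamma\beta-m\omega\alpha},$$ and let $\kappa\ge 0$ be defined by $$\kappa^2=\big(1-\kappa_1\sin(\theta-\phi^* )-\kappa_2\cos(2\phi^* )\big)^2+\big(-\kappa_1\cos(\theta-\phi^* )-\kappa_2\sin(2\phi^* )\big)^2.$$ For a small parameter $\epsilon>0$ let $T(t)=T_0+\epsilon T_1\cos(\omega t)$ and $q(t)=q_0+\epsilon u^*(t)$, where $$u^*(t)=q_1^*\cos(\omega t-\phi^* ),\qquad q_1^*=\frac{q_0\gamma T_1\sqrt{\alpha^2+\beta^2}}{T_0(2\gamma\beta-\alpha\omega m)},$$ is the control maximizing (to leading order in $\epsilon$) the power of the underdamped model. Let $\Sigma$ be the $\frac{2\pi}{\omega}$-periodic symmetric $2\times2$ matrix solution of $$\dot\Sigma=A(t)\Sigma+\Sigma A(t)'+\begin{bmatrix}0&0\\0&\frac{2\gamma k_BT(t)}{m^2}\end{bmatrix},\qquad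 A(t)=\begin{bmatrix}0&1\\-\frac{q(t)}{m}&-\frac{\gamma}{m}\end{bmatrix},$$ and let $$\mathcal W=-\frac12\int_0^{\frac{2\pi}{\omega}}\dot q(t)\Sigma_{11}(t)\,dt,\qquad \mathcal Q_h=\int_0^{\frac{2\pi}{\omega}}\Big(\gamma\Big(\frac{k_B}{m}T(t)-\Sigma_{22}(t)\Big)\Big)_+dt,\qquad \eta=\frac{\mathcal W}{\mathcal Q_h}.$$ Then, as $\epsilon\to0$, the heat intake and the efficiency at maximum power satisfy $$\mathcal Q_h=\epsilon\,\frac{2\kappa\gamma k_BT_1}{m\omega}+O(\epsilon^2),\qquad \eta=\epsilon\,\frac{\pi m\omega q_0\gamma T_1}{2\kappa T_0(2\gamma\beta-\alpha\omega m)}+O(\epsilon^2).$$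
   Context: Here $\angle z$ denotes the argument of the nonzero complex number $z$, $'$ denotes matrix transpose, and $(x)_+=\max\{0,x\}$. The setting is the scalar underdamped Langevin system $dX_t=v_t\,dt$, $m\,dv_t=-q(t)X_t\,dt-\gamma v_t\,dt+\sqrt{2\gamma k_BT(t)}\,dB_t$ with quadratic potential $\frac12q(t)x^2$. $\Sigma(t)$ is the periodic covariance matrix of $(X_t,v_t)'$ (which exists and is unique for $\epsilon$ small), $\mathcal W$ is the work extracted over a cycle, $\gamma(\frac{k_B}{m}T-\Sigma_{22})$ is the heat rate into the ensemble, $\mathcal Q_h$ is the heat flowing in over a cycle, and $\eta$ is the efficiency. *)

theory Defs
  imports "HOL-Analysis.Analysis" "HOL-Library.Landau_Symbols"
begin

text \<open>
  The functions \<open>q\<close>, \<open>T\<close> and \<open>S\<close> below are the stiffness of the potential, the temperature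
  and the covariance matrix of position and velocity, as functions of time.
\<close>

definition drift_matrix :: "real \<Rightarrow> real \<Rightarrow> (real \<Rightarrow> real) \<Rightarrow> real \<Rightarrow> real^2^2" where
  "drift_matrix m \<gamma> q t = vector [vector [0, 1], vector [- q t / m, - \<gamma> / m]]"

definition noise_matrix :: "real \<Rightarrow> real \<Rightarrow> real \<Rightarrow> (real \<Rightarrow> real) \<Rightarrow> real \<Rightarrow> real^2^2" where
  "noise_matrix m \<gamma> k\<^sub>B T t = vector [vector [0, 0], vector [0, 2 * \<gamma> * k\<^sub>B * T t / m\<^sup>2]]"

definition is_periodic_covariance ::
    "real \<Rightarrow> real \<Rightarrow> real \<Rightarrow> real \<Rightarrow> (real \<Rightarrow> real) \<Rightarrow> (real \<Rightarrow> real) \<Rightarrow> (real \<Rightarrow> real^2^2) \<Rightarrow> bool" where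
  "is_periodic_covariance m \<gamma> k\<^sub>B \<omega> q T S \<longleftrightarrow>
     (\<forall>t. transpose (S t) = S t) \<and>
     (\<forall>t. S (t + 2 * pi / \<omega>) = S t) \<and>
     (\<forall>t. (S has_vector_derivative
            (drift_matrix m \<gamma> q t ** S t + S t ** transpose (drift_matrix m \<gamma> q t)
              + noise_matrix m \<gamma> k\<^sub>B T t)) (at t))"

definition cycle_work :: "real \<Rightarrow> (real \<Rightarrow> real) \<Rightarrow> (real \<Rightarrow> real^2^2) \<Rightarrow> real" where
  "cycle_work \<omega> q S = - (1/2) * integral {0..2 * pi / \<omega>} (\<lambda>t. deriv q t * S t $ 1 $ 1)"

definition heat_intake ::
    "real \<Rightarrow> real \<Rightarrow> real \<Rightarrow> real \<Rightarrow> (real \<Rightarrow> real) \<Rightarrow> (real \<Rightarrow> real^2^2) \<Rightarrow> real" where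
  "heat_intake m \<gamma> k\<^sub>B \<omega> T S =
     integral {0..2 * pi / \<omega>} (\<lambda>t. max 0 (\<gamma> * (k\<^sub>B / m * T t - S t $ 2 $ 2)))"

definition efficiency ::
    "real \<Rightarrow> real \<Rightarrow> real \<Rightarrow> real \<Rightarrow> (real \<Rightarrow> real) \<Rightarrow> (real \<Rightarrow> real) \<Rightarrow> (real \<Rightarrow> real^2^2) \<Rightarrow> real" where
  "efficiency m \<gamma> k\<^sub>B \<omega> q T S = cycle_work \<omega> q S / heat_intake m \<gamma> k\<^sub>B \<omega> T S"

end

(* At epsilon = 0 the covariance system is linear, constant and exponentially stable with the
   equilibrium Sigma_11 = k_B T_0 / q_0, Sigma_12 = 0, Sigma_22 = k_B T_0 / m, and its first-order
   response to the harmonic control and temperature is harmonic.  The remainder is periodic and solves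
   the same linear system with a forcing that is O(epsilon^2) up to an O(epsilon) multiple of the
   remainder itself; since the derivative of a Lyapunov function vanishes where the function is
   maximal over a period, the remainder is O(epsilon^2) uniformly in time.  The heat rate is therefore
   epsilon |H| cos(omega t + const) + O(epsilon^2) with a complex amplitude H whose modulus is a
   multiple of kappa, and its positive part integrates to 2 epsilon |H| / omega.  The work
   has no first-order term, and its relative error is O(epsilon).  Dividing by the heat needs
   kappa > 0, which follows from the explicit formulas. *)

theory Submission
  imports Defs
begin

subsection \<open>Periodic functions and harmonics\<close>

text \<open>Subtracting whole periods moves any time into \<open>{0..p}\<close>, so a maximum over
  one period is global. This replaces decay estimates: functionals of periodic solutions are
  examined at their maximum.\<close>

lemma periodic_attains_max:
  fixes f :: "real \<Rightarrow> real"
  assumes p: "p > 0" and per: "\<And>t. f (t + p) = f t" and cont: "continuous_on UNIV f"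
  obtains s where "\<And>t. f t \<le> f s"
proof -
  interpret periodic_fun_simple f p
    by unfold_locales (simp add: per)
  have "\<exists>s\<in>{0..p}. \<forall>t\<in>{0..p}. f t \<le> f s"
    by (rule continuous_attains_sup) (use p cont continuous_on_subset in auto)
  then obtain s where s: "\<And>t. t \<in> {0..p} \<Longrightarrow> f t \<le> f s" by blast
  have "f t \<le> f s" for t
  proof -
    let ?n = "\<lfloor>t / p\<rfloor>"
    have "of_int ?n \<le> t / p" "t / p \<le> of_int ?n + 1" by linarith+
    hence "of_int ?n * p \<le> t" "t \<le> (of_int ?n + 1) * p"
      by (simp_all only: pos_le_divide_eq[OF p] pos_divide_le_eq[OF p])
    hence "t - of_int ?n * p \<in> {0..p}"
      by (simp add: algebra_simps)
    hence "f (t - of_int ?n * p) \<le> f s" by (rule s)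
    thus ?thesis by (simp add: minus_of_int)
  qed
  thus ?thesis using that by blast
qed

text \<open>Harmonics are represented throughout by a complex amplitude \<open>c\<close>.
  Differentiation multiplies the amplitude by \<open>\<i> * w\<close>, so the first-order
  differential equations become algebraic.\<close>

lemma has_real_derivative_Re_mult_cis:
  "((\<lambda>t. Re (c * cis (w * t))) has_real_derivative Re (\<i> * of_real w * c * cis (w * t))) (at t within S)"
  by (auto intro!: derivative_eq_intros simp: algebra_simps)

lemma Re_mult_cis_periodic:
  assumes "w \<noteq> 0"
  shows "Re (c * cis (w * (t + 2 * pi / w))) = Re (c * cis (w * t))"
proof -
  have "w * (t + 2 * pi / w) = w * t + 2 * pi" using assms by (simp add: field_simps)
  thus ?thesis by simp
qed

lemma abs_Re_mult_cis_le: "\<bar>Re (c * cis s)\<bar> \<le> cmod c"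
  using abs_Re_le_cmod[of "c * cis s"] by (simp add: norm_mult)

text \<open>The interval enters only through \<open>cis (w * p) = 1\<close>, so the lemma also
  serves for the doubled frequency over the same period.\<close>

lemma has_integral_Re_mult_cis_zero:
  assumes "w \<noteq> 0" "p \<ge> 0" "cis (w * p) = 1"
  shows "((\<lambda>t. Re (c * cis (w * t))) has_integral 0) {0..p}"
proof -
  let ?c = "c / (\<i> * of_real w)"
  have "((\<lambda>t. Re (c * cis (w * t))) has_integral Re (?c * cis (w * p)) - Re (?c * cis (w * 0))) {0..p}"
  proof (rule fundamental_theorem_of_calculus[OF assms(2)])
    fix t
    have "\<i> * of_real w * ?c = c" using assms by simp
    thus "((\<lambda>t. Re (?c * cis (w * t))) has_vector_derivative Re (c * cis (w * t))) (at t within {0..p})"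
      using has_real_derivative_Re_mult_cis[of ?c w t "{0..p}"]
      by (simp only: has_real_derivative_iff_has_vector_derivative)
  qed
  thus ?thesis using assms by simp
qed

text \<open>The first summand is the mean of the product; the second is a harmonic of twice the
  frequency and vanishes on integration over a period.\<close>

lemma Re_mult_Re_cis:
  "Re (a * cis s) * Re (b * cis s) = Re (a * cnj b) / 2 + Re (a * b / 2 * cis (2 * s))"
proof -
  have "Re (a * cnj b) / 2 * (cos s * cos s + sin s * sin s) + Re (a * b / 2 * cis (2 * s))
      = Re (a * cis s) * Re (b * cis s)"
    unfolding cis_mult[symmetric] mult_2 
    by (simp add: cos_add sin_add field_simps del: sin_cos_squared_add3)
  moreover have "cos s * cos s + sin s * sin s = 1"
    using sin_cos_squared_add3 by blast
  ultimately show ?thesis by simp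
qed

lemma has_integral_Re_mult_Re_cis:
  assumes "w > 0"
  shows "((\<lambda>t. Re (a * cis (w * t)) * Re (b * cis (w * t))) has_integral pi / w * Re (a * cnj b))
           {0..2 * pi / w}"
proof -
  have "((\<lambda>t. Re (a * b / 2 * cis (2 * w * t))) has_integral 0) {0..2 * pi / w}"
  proof (rule has_integral_Re_mult_cis_zero)
    have "2 * w * (2 * pi / w) = 2 * pi + 2 * pi" using assms by simp
    thus "cis (2 * w * (2 * pi / w)) = 1" by (simp add: complex_eq_iff)
  qed (use assms in auto)
  moreover have "((\<lambda>t. Re (a * cnj b) / 2) has_integral (2 * pi / w) * (Re (a * cnj b) / 2)) {0..2 * pi / w}"
    using has_integral_const_real[of "Re (a * cnj b) / 2" 0 "2 * pi / w"] assms by simp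
  ultimately have "((\<lambda>t. Re (a * cnj b) / 2 + Re (a * b / 2 * cis (2 * w * t))) has_integral
      (2 * pi / w) * (Re (a * cnj b) / 2) + 0) {0..2 * pi / w}"
    using has_integral_add by blast
  thus ?thesis by (simp add: Re_mult_Re_cis mult.assoc del: times_complex.simps)
qed

section \<open>The positive part of a harmonic over one period\<close>

lemma has_integral_periodic_shift:
  fixes f :: "real \<Rightarrow> real"
  assumes I: "(f has_integral I) {0..p}" and per: "\<And>t. f (t + p) = f t" and s: "0 \<le> s" "s \<le> p"
  shows "(f has_integral I) {s..s + p}"
proof -
  have f: "f integrable_on {0..p}" using I by blast
  obtain I1 where I1: "(f has_integral I1) {0..s}"
    using integrable_subinterval_real[OF f, of 0 s] s by auto
  obtain I2 where I2: "(f has_integral I2) {s..p}"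
    using integrable_subinterval_real[OF f, of s p] s by auto
  have "(f has_integral I1 + I2) {0..p}"
    by (rule has_integral_combine[OF _ _ I1 I2]) (use s in auto)
  hence I_eq: "I = I1 + I2" using I has_integral_unique by blast
  \<comment> \<open>The piece over \<open>{0..s}\<close> is moved by one period to
    \<open>{p..s + p}\<close>, where it continues the piece over \<open>{s..p}\<close>.\<close>
  have "((\<lambda>x. f (x + p)) has_integral I1) {0..s}" using I1 per by simp
  hence "(f has_integral I1) {p..s + p}"
    using has_integral_shift_Icc_real[of f p I1 0 s] by (simp add: o_def add.commute)
  hence "(f has_integral I2 + I1) {s..s + p}"
    by (rule has_integral_combine[OF _ _ I2, rotated 2]) (use s in auto)
  thus ?thesis by (simp add: I_eq add.commute)
qed

lemma has_integral_max_sin: "((\<lambda>s. max 0 (sin s)) has_integral 2) {0..2 * pi}"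
proof -
  have "(sin has_integral (- cos pi) - (- cos 0)) {0..pi}"
    by (rule fundamental_theorem_of_calculus)
       (auto intro!: derivative_eq_intros simp flip: has_real_derivative_iff_has_vector_derivative)
  hence 1: "((\<lambda>s. max 0 (sin s)) has_integral 2) {0..pi}"
    using has_integral_cong[of "{0..pi}" sin "\<lambda>s. max 0 (sin s)" 2] sin_ge_zero by simp
  have "((\<lambda>s::real. 0::real) has_integral 0) {pi..2 * pi}" by simp
  moreover have "max 0 (sin s) = 0" if "s \<in> {pi..2 * pi}" for s
    using that sin_ge_zero[of "s - pi"] by simp
  ultimately have 2: "((\<lambda>s. max 0 (sin s)) has_integral 0) {pi..2 * pi}"
    using has_integral_cong[of "{pi..2 * pi}" "\<lambda>s. max 0 (sin s)" "\<lambda>s. 0" 0] by simp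
  have "((\<lambda>s. max 0 (sin s)) has_integral 2 + 0) {0..2 * pi}"
    by (rule has_integral_combine[OF _ _ 1 2]) auto
  thus ?thesis by simp
qed

text \<open>Every harmonic is \<open>cmod c\<close> times a shifted sine. By periodicity the shift
  does not affect the integral, and the positive half-wave of the sine has area 2.\<close>

lemma has_integral_max_Re_mult_cis:
  assumes "w > 0"
  shows "((\<lambda>t. max 0 (Re (c * cis (w * t)))) has_integral 2 * cmod c / w) {0..2 * pi / w}"
proof -
  \<comment> \<open>The factor \<open>\<i>\<close> turns the cosine of the real part into a sine.
    \<open>Arg2pi\<close> places the phase in \<open>{0..2 * pi}\<close>, as the shift lemma
    requires.\<close>
  define s where "s = Arg2pi (\<i> * c)"
  have "\<i> * c = cmod c * cis s"
    using Arg2pi_eq[of "\<i> * c"] by (simp add: s_def norm_mult cis_conv_exp)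
  hence c: "c = - \<i> * (cmod c * cis s)" by (metis complex_i_mult_minus mult_minus_left minus_minus)
  have Re: "Re (c * cis t) = cmod c * sin (t + s)" for t
    by (subst c) (simp add: sin_add algebra_simps)
  have s: "0 \<le> s" "s \<le> 2 * pi" using Arg2pi_ge_0 Arg2pi_lt_2pi by (auto simp: s_def less_imp_le)
  have "((\<lambda>x. max 0 (sin x)) has_integral 2) (cbox s (s + 2 * pi))"
    using has_integral_periodic_shift[OF has_integral_max_sin _ s] by simp
  from has_integral_affinity'[OF this assms, of s]
  have "((\<lambda>x. max 0 (sin (w * x + s))) has_integral 2 / w) {0..2 * pi / w}"
    by (simp add: divide_inverse mult.commute)
  from has_integral_mult_right[OF this, of "cmod c"]
  show ?thesis by (simp add: Re max_mult_distrib_left mult.commute del: times_complex.simps)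
qed

subsection \<open>The linearised covariance system\<close>

text \<open>The difference of the two sides is a square. The weight \<open>s\<close> decides how the
  cross terms below are split.\<close>

lemma young: "s > 0 \<Longrightarrow> p * q \<le> s * p\<^sup>2 + q\<^sup>2 / (4 * s)" for p q s :: real
proof -
  assume "s > 0"
  hence "s * p\<^sup>2 + q\<^sup>2 / (4 * s) - p * q = (2 * s * p - q)\<^sup>2 / (4 * s)"
    by (simp add: field_simps power2_eq_square)
  also have "\<dots> \<ge> 0" using \<open>s > 0\<close> by simp
  finally show ?thesis by simp
qed

text \<open>With \<open>D = z - a x\<close> and \<open>E = z + a x\<close>, the form \<open>4 a y\<^sup>2 + D\<^sup>2 + E\<^sup>2\<close> dissipates only in the
  directions \<open>y\<close> and \<open>D + E\<close>; the small cross term makes the dissipation definite.\<close>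

definition lyap :: "real \<Rightarrow> real \<Rightarrow> real \<Rightarrow> real \<Rightarrow> real \<Rightarrow> real" where
  "lyap a d y D E = 4 * a * y\<^sup>2 + D\<^sup>2 + E\<^sup>2 - 2 * d * y * D"

text \<open>Young's inequality splits the cross term into \<open>D\<^sup>2 / 2\<close> and
  \<open>2 * d\<^sup>2 * y\<^sup>2\<close>, and the smallness of \<open>d\<close> bounds the latter
  by \<open>a * y\<^sup>2\<close>. Hence \<open>lyap\<close> is equivalent to the plain quadratic
  norm.\<close>

lemma lyap_bounds:
  assumes "a > 0" "d > 0" "d\<^sup>2 \<le> a / 2"
  shows "(a * y\<^sup>2 + D\<^sup>2 + E\<^sup>2) / 2 \<le> lyap a d y D E"
    and "lyap a d y D E \<le> 5 * (a * y\<^sup>2 + D\<^sup>2 + E\<^sup>2)"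
proof -
  have 1: "2 * (d * y * D) \<le> D\<^sup>2 / 2 + 2 * (d\<^sup>2 * y\<^sup>2)" "- 2 * (d * y * D) \<le> D\<^sup>2 / 2 + 2 * (d\<^sup>2 * y\<^sup>2)"
    using young[of "1/2" D "2 * d * y"] young[of "1/2" D "- (2 * d * y)"]
    by (simp_all add: power_mult_distrib mult_ac)
  have "d\<^sup>2 * y\<^sup>2 \<le> (a / 2) * y\<^sup>2" using assms by (intro mult_right_mono) auto
  hence 2: "2 * (d\<^sup>2 * y\<^sup>2) \<le> a * y\<^sup>2" by simp
  have 3: "0 \<le> a * y\<^sup>2" "0 \<le> D\<^sup>2" "0 \<le> E\<^sup>2" using assms by auto
  have 4: "lyap a d y D E = 4 * (a * y\<^sup>2) + D\<^sup>2 + E\<^sup>2 - 2 * (d * y * D)"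
    by (simp add: lyap_def)
  \<comment> \<open>With the products replaced by fresh variables, only linear inequalities
    remain.\<close>
  have "(Y + D2 + E2) / 2 \<le> L \<and> L \<le> 5 * (Y + D2 + E2)"
    if "2 * P \<le> D2 / 2 + 2 * W" "- 2 * P \<le> D2 / 2 + 2 * W" "2 * W \<le> Y" "0 \<le> Y" "0 \<le> D2" "0 \<le> E2"
      "L = 4 * Y + D2 + E2 - 2 * P" for Y D2 E2 P W L :: real
    using that by (simp add: field_simps)
  from this[OF 1 2 3 4] show "(a * y\<^sup>2 + D\<^sup>2 + E\<^sup>2) / 2 \<le> lyap a d y D E"
    and "lyap a d y D E \<le> 5 * (a * y\<^sup>2 + D\<^sup>2 + E\<^sup>2)" by auto
qed

text \<open>The left side is half the derivative of \<open>lyap\<close> along the unforced system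
  \<open>y' = D - g * y\<close>, \<open>D' = - 4 * a * y - g * (E + D)\<close>,
  \<open>E' = - g * (E + D)\<close>.\<close>

lemma lyap_dissipation:
  fixes a g d y D E :: real
  assumes "a > 0" "g > 0" "d > 0" "d \<le> g / 2" "d * g \<le> a" "d\<^sup>2 \<le> a / 2"
  shows "4 * a * y * (D - g * y) + D * (- 4 * a * y - g * (E + D)) - E * (g * (E + D))
           - d * ((D - g * y) * D + y * (- 4 * a * y - g * (E + D)))
         \<le> - (d / 8) * (a * y\<^sup>2 + D\<^sup>2 + E\<^sup>2)" (is "?L \<le> _")
proof -
  define A B P P' S S' D2 E2 where "A = a * (g * y\<^sup>2)" and "B = a * (d * y\<^sup>2)"
    and "P = d * (D * (g * y))" and "P' = g * ((D + E) * (d * y))"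
    and "S = g * (D + E)\<^sup>2" and "S' = d * (D + E)\<^sup>2" and "D2 = d * D\<^sup>2" and "E2 = d * E\<^sup>2"
  note defs = this
  \<comment> \<open>Without the cross term only \<open>- 4 * A - S\<close> is left. The cross term
    adds the missing \<open>- D2\<close>, at the price of \<open>4 * B + P + P'\<close>, which is
    absorbed next.\<close>
  have L: "?L = - 4 * A - S - D2 + 4 * B + P + P'"
    by (simp add: defs algebra_simps power2_eq_square)
  have "d * (D * (g * y)) \<le> d * (D\<^sup>2 / 2 + (g * y)\<^sup>2 / 2)"
    using young[of "1/2" D "g * y"] assms by (intro mult_left_mono) auto
  also have "\<dots> = D2 / 2 + (d * g) * (g * y\<^sup>2) / 2"
    by (simp add: defs algebra_simps power2_eq_square)
  also have "(d * g) * (g * y\<^sup>2) \<le> a * (g * y\<^sup>2)" using assms by (intro mult_right_mono) auto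
  finally have 1: "P \<le> D2 / 2 + A / 2" by (simp add: defs)
  have "g * ((D + E) * (d * y)) \<le> g * ((D + E)\<^sup>2 / 2 + (d * y)\<^sup>2 / 2)"
    using young[of "1/2" "D + E" "d * y"] assms by (intro mult_left_mono) auto
  also have "\<dots> = S / 2 + d\<^sup>2 * (g * y\<^sup>2) / 2"
    by (simp add: defs algebra_simps power2_eq_square)
  also have "d\<^sup>2 * (g * y\<^sup>2) \<le> a / 2 * (g * y\<^sup>2)" using assms by (intro mult_right_mono) auto
  finally have 2: "P' \<le> S / 2 + A / 4" by (simp add: defs)
  have "d * (a * y\<^sup>2) \<le> g / 2 * (a * y\<^sup>2)" using assms by (intro mult_right_mono) auto
  hence 3: "B \<le> A / 2" by (simp add: defs mult_ac)
  have "d * (D + E)\<^sup>2 \<le> g / 2 * (D + E)\<^sup>2" using assms by (intro mult_right_mono) auto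
  hence 4: "S' \<le> S / 2" by (simp add: defs)
  \<comment> \<open>The direction \<open>E\<close> has no dissipation of its own; it is recovered
    from \<open>D\<close> and \<open>D + E\<close>.\<close>
  have "2 * (D + E)\<^sup>2 + 2 * D\<^sup>2 - E\<^sup>2 = (2 * D + E)\<^sup>2" by (simp add: power2_eq_square algebra_simps)
  hence "E\<^sup>2 \<le> 2 * (D + E)\<^sup>2 + 2 * D\<^sup>2" using zero_le_power2[of "2 * D + E"] by linarith
  hence "d * E\<^sup>2 \<le> d * (2 * (D + E)\<^sup>2 + 2 * D\<^sup>2)" using assms by (intro mult_left_mono) auto
  hence 5: "E2 \<le> 2 * S' + 2 * D2" by (simp add: defs distrib_left)
  have "0 \<le> D2" "0 \<le> B" "0 \<le> S'" using assms by (auto simp: defs)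
  with 1 2 3 4 5 have "?L \<le> - (B + D2 + E2) / 8" unfolding L by simp
  thus ?thesis by (simp add: defs algebra_simps)
qed

text \<open>Forcing terms \<open>f\<close> in \<open>y'\<close> and \<open>h\<close> in
  \<open>D'\<close> and \<open>E'\<close> contribute the left side. The Young weights are chosen to
  use up exactly \<open>d / 16\<close>, half of the dissipation rate \<open>d / 8\<close>.\<close>

lemma lyap_forcing:
  fixes a d f h F y D E :: real
  assumes "a > 0" "d > 0" "\<bar>f\<bar> \<le> F" "\<bar>h\<bar> \<le> F"
  shows "4 * a * y * f + D * h + E * h - d * (f * D + y * h)
         \<le> (d / 16) * (a * y\<^sup>2 + D\<^sup>2 + E\<^sup>2) + (128 * a / d + 12 / d + 8 * d + 8 * d / a) * F\<^sup>2"
proof -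
  have F: "f\<^sup>2 \<le> F\<^sup>2" "h\<^sup>2 \<le> F\<^sup>2" 
    using power_mono[OF assms(3), of 2] power_mono[OF assms(4), of 2] by simp_all
  have "(a * (4 * (y * f))) \<le> a * ((d / 32) * y\<^sup>2 + (4 * f)\<^sup>2 / (4 * (d / 32)))"
    using young[of "d / 32" y "4 * f"] assms by (intro mult_left_mono) auto
  also have "\<dots> = (d / 32) * (a * y\<^sup>2) + 128 * a / d * f\<^sup>2" using assms by (simp add: field_simps)
  also have "\<dots> \<le> (d / 32) * (a * y\<^sup>2) + 128 * a / d * F\<^sup>2"
    using F assms by (intro add_left_mono mult_left_mono) auto
  finally have 1: "4 * a * y * f \<le> (d / 32) * (a * y\<^sup>2) + 128 * a / d * F\<^sup>2" by (simp add: mult_ac)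
  have "D * h \<le> (d / 32) * D\<^sup>2 + 8 / d * h\<^sup>2"
    using young[of "d / 32" D h] assms by (simp add: field_simps)
  also have "\<dots> \<le> (d / 32) * D\<^sup>2 + 8 / d * F\<^sup>2"
    using F assms by (intro add_left_mono mult_left_mono) auto
  finally have 2: "D * h \<le> (d / 32) * D\<^sup>2 + 8 / d * F\<^sup>2" .
  have "E * h \<le> (d / 16) * E\<^sup>2 + 4 / d * h\<^sup>2"
    using young[of "d / 16" E h] assms by (simp add: field_simps)
  also have "\<dots> \<le> (d / 16) * E\<^sup>2 + 4 / d * F\<^sup>2"
    using F assms by (intro add_left_mono mult_left_mono) auto
  finally have 3: "E * h \<le> (d / 16) * E\<^sup>2 + 4 / d * F\<^sup>2" .
  have "d * (D * (- f)) \<le> d * ((1 / 32) * D\<^sup>2 + 8 * f\<^sup>2)"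
    using young[of "1 / 32" D "- f"] assms by (intro mult_left_mono) auto
  also have "\<dots> \<le> d * ((1 / 32) * D\<^sup>2 + 8 * F\<^sup>2)"
    using F assms by (intro mult_left_mono add_left_mono) auto
  finally have 4: "- d * (f * D) \<le> (d / 32) * D\<^sup>2 + 8 * d * F\<^sup>2" by (simp add: algebra_simps)
  have "d * (y * (- h)) \<le> d * ((a / 32) * y\<^sup>2 + 8 / a * h\<^sup>2)"
    using young[of "a / 32" y "- h"] assms by (intro mult_left_mono) (auto simp: field_simps)
  also have "\<dots> \<le> d * ((a / 32) * y\<^sup>2 + 8 / a * F\<^sup>2)"
    using F assms by (intro mult_left_mono add_left_mono) auto
  finally have 5: "- d * (y * h) \<le> (d / 32) * (a * y\<^sup>2) + 8 * d / a * F\<^sup>2" by (simp add: algebra_simps)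
  show ?thesis using 1 2 3 4 5 by (simp add: distrib_left distrib_right)
qed

lemma lyap_derivative:
  assumes "(y has_real_derivative y') (at t)" "(D has_real_derivative D') (at t)"
    "(E has_real_derivative E') (at t)"
  shows "((\<lambda>t. lyap a d (y t) (D t) (E t)) has_real_derivative
           2 * (4 * a * y t * y' + D t * D' + E t * E' - d * (y' * D t + y t * D'))) (at t)"
  unfolding lyap_def power2_eq_square
  by (rule derivative_eq_intros assms refl | simp add: algebra_simps)+

text \<open>At its maximum over a period the Lyapunov function has derivative zero, so dissipation
  and forcing balance there and the norm is at most a multiple of \<open>F\<^sup>2\<close>. The
  constant depends on \<open>a\<close> and \<open>g\<close> only and is fixed before the period, the
  forcing and the solution.\<close>

lemma periodic_response_bound:
  fixes a g :: real
  assumes "a > 0" "g > 0"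
  obtains C where "C > 0"
    and "\<And>p F (x :: real \<Rightarrow> real) y z f h t. p > 0 \<Longrightarrow>
      (\<And>t. x (t + p) = x t) \<Longrightarrow> (\<And>t. y (t + p) = y t) \<Longrightarrow> (\<And>t. z (t + p) = z t) \<Longrightarrow>
      (\<And>t. (x has_real_derivative 2 * y t) (at t)) \<Longrightarrow>
      (\<And>t. (y has_real_derivative z t - a * x t - g * y t + f t) (at t)) \<Longrightarrow>
      (\<And>t. (z has_real_derivative - 2 * a * y t - 2 * g * z t + h t) (at t)) \<Longrightarrow>
      (\<And>t. \<bar>f t\<bar> \<le> F) \<Longrightarrow> (\<And>t. \<bar>h t\<bar> \<le> F) \<Longrightarrow>
      \<bar>x t\<bar> \<le> C * F \<and> \<bar>y t\<bar> \<le> C * F \<and> \<bar>z t\<bar> \<le> C * F"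
proof -
  \<comment> \<open>The three entries give the three smallness conditions of
    \<open>lyap_dissipation\<close>.\<close>
  define d where "d = min (g / 2) (min (a / g) (sqrt (a / 2)))"
  have d: "d > 0" "d \<le> g / 2"
    using assms by (simp_all only: d_def min.cobounded1) simp
  have "d \<le> a / g" by (simp add: d_def)
  hence dg: "d * g \<le> a" using assms by (simp add: pos_le_divide_eq)
  have "d\<^sup>2 \<le> (sqrt (a / 2))\<^sup>2" using d by (intro power_mono) (auto simp: d_def)
  hence d2: "d\<^sup>2 \<le> a / 2" using assms by simp
  define K where "K = 128 * a / d + 12 / d + 8 * d + 8 * d / a"
  have "K > 0" using assms d by (auto simp: K_def intro!: add_pos_pos)
  \<comment> \<open>The balance at the maximum gives \<open>16 * K / d\<close>; the two bounds of
    \<open>lyap_bounds\<close> contribute the factors 5 and 2.\<close>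
  define M where "M = 160 * K / d"
  have "M > 0" using \<open>K > 0\<close> d by (simp add: M_def)
  \<comment> \<open>The summands 1, \<open>1 / a\<close> and \<open>1 / a\<^sup>2\<close> serve the
    bounds on \<open>z\<close>, \<open>y\<close> and \<open>x\<close> respectively.\<close>
  define C where "C = sqrt (M * (1 + 1 / a + 1 / a\<^sup>2))"
  have "C > 0" using \<open>M > 0\<close> assms by (auto simp: C_def intro!: mult_pos_pos add_pos_pos)
  have C2: "C\<^sup>2 = M * (1 + 1 / a + 1 / a\<^sup>2)"
    using \<open>M > 0\<close> assms by (simp add: C_def)
  show ?thesis
  proof (rule that[OF \<open>C > 0\<close>])
    fix p F t and x y z f h :: "real \<Rightarrow> real"
    assume p: "p > 0"
      and per: "\<And>t. x (t + p) = x t" "\<And>t. y (t + p) = y t" "\<And>t. z (t + p) = z t"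
      and x': "\<And>t. (x has_real_derivative 2 * y t) (at t)"
      and y': "\<And>t. (y has_real_derivative z t - a * x t - g * y t + f t) (at t)"
      and z': "\<And>t. (z has_real_derivative - 2 * a * y t - 2 * g * z t + h t) (at t)"
      and f: "\<And>t. \<bar>f t\<bar> \<le> F" and h: "\<And>t. \<bar>h t\<bar> \<le> F"
    define D where "D = (\<lambda>t. z t - a * x t)"
    define E where "E = (\<lambda>t. z t + a * x t)"
    define N where "N = (\<lambda>t. a * (y t)\<^sup>2 + (D t)\<^sup>2 + (E t)\<^sup>2)"
    define V where "V = (\<lambda>t. lyap a d (y t) (D t) (E t))"
    have D': "(D has_real_derivative - 4 * a * y t - g * (E t + D t) + h t) (at t)" for t
      unfolding D_def E_def
      by (rule derivative_eq_intros x' z' refl | simp add: algebra_simps)+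
    have E': "(E has_real_derivative - g * (E t + D t) + h t) (at t)" for t
      unfolding D_def E_def
      by (rule derivative_eq_intros x' z' refl | simp add: algebra_simps)+
    have y'': "(y has_real_derivative D t - g * y t + f t) (at t)" for t
      using y'[of t] by (simp add: D_def)
    have V': "(V has_real_derivative 2 * (4 * a * y t * (D t - g * y t + f t)
        + D t * (- 4 * a * y t - g * (E t + D t) + h t) + E t * (- g * (E t + D t) + h t)
        - d * ((D t - g * y t + f t) * D t + y t * (- 4 * a * y t - g * (E t + D t) + h t)))) (at t)" for t
      unfolding V_def by (rule lyap_derivative[OF y'' D' E'])
    have "continuous_on UNIV V"
      by (rule DERIV_continuous_on[OF has_field_derivative_at_within[OF V']])
    moreover have "V (t + p) = V t" for t by (simp add: V_def D_def E_def per)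
    ultimately obtain s where s: "\<And>t. V t \<le> V s" using periodic_attains_max[OF p] by blast
    have "2 * (4 * a * y s * (D s - g * y s + f s)
        + D s * (- 4 * a * y s - g * (E s + D s) + h s) + E s * (- g * (E s + D s) + h s)
        - d * ((D s - g * y s + f s) * D s + y s * (- 4 * a * y s - g * (E s + D s) + h s))) = 0"
      by (rule DERIV_local_max[OF V'[of s], of 1]) (use s in auto)
    hence "(4 * a * y s * (D s - g * y s) + D s * (- 4 * a * y s - g * (E s + D s)) - E s * (g * (E s + D s))
           - d * ((D s - g * y s) * D s + y s * (- 4 * a * y s - g * (E s + D s))))
         + (4 * a * y s * f s + D s * h s + E s * h s - d * (f s * D s + y s * h s)) = 0" (is "?P + ?Q = 0")
      by (simp add: algebra_simps)
    moreover have "?P \<le> - (d / 8) * N s"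
      unfolding N_def by (rule lyap_dissipation[OF assms d dg d2])
    moreover have "?Q \<le> (d / 16) * N s + K * F\<^sup>2"
      unfolding N_def K_def by (rule lyap_forcing[OF assms(1) d(1) f h])
    ultimately have "d / 16 * N s \<le> K * F\<^sup>2" by linarith
    hence Ns: "N s \<le> 16 * K / d * F\<^sup>2" using d by (simp add: field_simps)
    have "N t / 2 \<le> V t" "V s \<le> 5 * N s"
      using lyap_bounds[OF assms(1) d(1) d2] by (auto simp: V_def N_def)
    with s[of t] Ns have N: "N t \<le> M * F\<^sup>2" by (simp add: M_def)
    have nn: "0 \<le> a * (y t)\<^sup>2" "0 \<le> (D t)\<^sup>2" "0 \<le> (E t)\<^sup>2" using assms by auto
    have C2F: "(C * F)\<^sup>2 = M * F\<^sup>2 + M * F\<^sup>2 / a + M * F\<^sup>2 / a\<^sup>2"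
      by (simp add: power_mult_distrib C2 algebra_simps)
    have MF: "0 \<le> M * F\<^sup>2" "0 \<le> M * F\<^sup>2 / a" "0 \<le> M * F\<^sup>2 / a\<^sup>2" using \<open>M > 0\<close> assms by auto
    have "(D t)\<^sup>2 + (E t)\<^sup>2 = 2 * (z t)\<^sup>2 + 2 * (a * x t)\<^sup>2"
      by (simp add: D_def E_def power2_eq_square algebra_simps)
    with N nn have zx: "(z t)\<^sup>2 \<le> M * F\<^sup>2" "(a * x t)\<^sup>2 \<le> M * F\<^sup>2" and "a * (y t)\<^sup>2 \<le> M * F\<^sup>2"
      unfolding N_def using zero_le_power2[of "z t"] zero_le_power2[of "a * x t"] by linarith+
    hence "(x t)\<^sup>2 \<le> M * F\<^sup>2 / a\<^sup>2" "(y t)\<^sup>2 \<le> M * F\<^sup>2 / a"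
      using assms by (simp_all add: pos_le_divide_eq power_mult_distrib mult.commute)
    with zx(1) MF have "(x t)\<^sup>2 \<le> (C * F)\<^sup>2" "(y t)\<^sup>2 \<le> (C * F)\<^sup>2" "(z t)\<^sup>2 \<le> (C * F)\<^sup>2"
      unfolding C2F by linarith+
    moreover have "0 \<le> C * F" using f[of 0] \<open>C > 0\<close> by simp
    ultimately show "\<bar>x t\<bar> \<le> C * F \<and> \<bar>y t\<bar> \<le> C * F \<and> \<bar>z t\<bar> \<le> C * F"
      by (metis abs_le_square_iff abs_of_nonneg)
  qed
qed

text \<open>The amplitudes \<open>xh\<close>, \<open>yh\<close>, \<open>zh\<close> solve the
  first-order equations, and \<open>z0 = a * x0\<close> makes \<open>(x0, 0, z0)\<close> the
  equilibrium. The remainder solves the constant system with a forcing that contains the remainder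
  itself; for small \<epsilon> this feedback is absorbed.\<close>

lemma linear_response:
  fixes a g w x0 z0 b :: real and U xh yh zh :: complex
  assumes a: "a > 0" and g: "g > 0" and w: "w > 0" and z0: "z0 = a * x0"
    and xh: "\<i> * w * xh = 2 * yh"
    and yh: "\<i> * w * yh = zh - a * xh - g * yh - x0 * U"
    and zh: "\<i> * w * zh = - 2 * a * yh - 2 * g * zh + b"
  obtains C \<epsilon>\<^sub>0 where "C \<ge> 0" "\<epsilon>\<^sub>0 > 0"
    and "\<And>\<epsilon> (x :: real \<Rightarrow> real) y z t. 0 < \<epsilon> \<Longrightarrow> \<epsilon> < \<epsilon>\<^sub>0 \<Longrightarrow>
      (\<And>t. x (t + 2 * pi / w) = x t) \<Longrightarrow> (\<And>t. y (t + 2 * pi / w) = y t) \<Longrightarrow>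
      (\<And>t. z (t + 2 * pi / w) = z t) \<Longrightarrow>
      (\<And>t. (x has_real_derivative 2 * y t) (at t)) \<Longrightarrow>
      (\<And>t. (y has_real_derivative
         z t - (a + \<epsilon> * Re (U * cis (w * t))) * x t - g * y t) (at t)) \<Longrightarrow>
      (\<And>t. (z has_real_derivative
         - 2 * (a + \<epsilon> * Re (U * cis (w * t))) * y t - 2 * g * z t
         + 2 * g * z0 + \<epsilon> * b * cos (w * t)) (at t)) \<Longrightarrow>
      \<bar>x t - x0 - \<epsilon> * Re (xh * cis (w * t))\<bar> \<le> C * \<epsilon>\<^sup>2 \<and>
      \<bar>z t - z0 - \<epsilon> * Re (zh * cis (w * t))\<bar> \<le> C * \<epsilon>\<^sup>2"
proof -
  obtain K where K: "K > 0"
    and bound: "\<And>p F (x :: real \<Rightarrow> real) y z f h t. p > 0 \<Longrightarrow>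
      (\<And>t. x (t + p) = x t) \<Longrightarrow> (\<And>t. y (t + p) = y t) \<Longrightarrow> (\<And>t. z (t + p) = z t) \<Longrightarrow>
      (\<And>t. (x has_real_derivative 2 * y t) (at t)) \<Longrightarrow>
      (\<And>t. (y has_real_derivative z t - a * x t - g * y t + f t) (at t)) \<Longrightarrow>
      (\<And>t. (z has_real_derivative - 2 * a * y t - 2 * g * z t + h t) (at t)) \<Longrightarrow>
      (\<And>t. \<bar>f t\<bar> \<le> F) \<Longrightarrow> (\<And>t. \<bar>h t\<bar> \<le> F) \<Longrightarrow>
      \<bar>x t\<bar> \<le> K * F \<and> \<bar>y t\<bar> \<le> K * F \<and> \<bar>z t\<bar> \<le> K * F"
    using periodic_response_bound[OF a g] by metis
  define u where "u = cmod U"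
  define k where "k = cmod xh + cmod yh"
  have u: "u \<ge> 0" and k: "k \<ge> 0" by (simp_all add: u_def k_def)
  \<comment> \<open>Below this threshold \<open>4 * K * u * \<epsilon> \<le> 1 / 2\<close>; the
    \<open>+ 1\<close> keeps the quotient meaningful when \<open>u = 0\<close>.\<close>
  define \<epsilon>\<^sub>0 where "\<epsilon>\<^sub>0 = 1 / (8 * K * (u + 1))"
  define C where "C = K * (4 * u * k)"
  show thesis
  proof (rule that)
    show "C \<ge> 0" "\<epsilon>\<^sub>0 > 0" using K u k by (simp_all add: C_def \<epsilon>\<^sub>0_def)
    fix \<epsilon> t and x y z :: "real \<Rightarrow> real"
    assume \<epsilon>: "0 < \<epsilon>" "\<epsilon> < \<epsilon>\<^sub>0"
      and per: "\<And>t. x (t + 2 * pi / w) = x t" "\<And>t. y (t + 2 * pi / w) = y t"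
        "\<And>t. z (t + 2 * pi / w) = z t"
      and x': "\<And>t. (x has_real_derivative 2 * y t) (at t)"
      and y': "\<And>t. (y has_real_derivative
         z t - (a + \<epsilon> * Re (U * cis (w * t))) * x t - g * y t) (at t)"
      and z': "\<And>t. (z has_real_derivative
         - 2 * (a + \<epsilon> * Re (U * cis (w * t))) * y t - 2 * g * z t
         + 2 * g * z0 + \<epsilon> * b * cos (w * t)) (at t)"
    define v where "v = (\<lambda>t. Re (U * cis (w * t)))"
    define x1 where "x1 = (\<lambda>t. Re (xh * cis (w * t)))"
    define y1 where "y1 = (\<lambda>t. Re (yh * cis (w * t)))"
    define z1 where "z1 = (\<lambda>t. Re (zh * cis (w * t)))"
    have harmonic: "((\<lambda>t. Re (c * cis (w * t))) has_real_derivative Re (e * cis (w * t))) (at t)"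
      if "\<i> * w * c = e" for c e t
      using has_real_derivative_Re_mult_cis[of c w t UNIV] that by simp
    have x1': "(x1 has_real_derivative 2 * y1 t) (at t)" for t
      using harmonic[OF xh, of t] by (simp add: x1_def y1_def algebra_simps)
    have y1': "(y1 has_real_derivative z1 t - a * x1 t - g * y1 t - x0 * v t) (at t)" for t
      using harmonic[OF yh, of t] by (simp add: x1_def y1_def z1_def v_def algebra_simps)
    have z1': "(z1 has_real_derivative - 2 * a * y1 t - 2 * g * z1 t + b * cos (w * t)) (at t)" for t
      using harmonic[OF zh, of t] by (simp add: y1_def z1_def algebra_simps)
    define X where "X = (\<lambda>t. x t - x0 - \<epsilon> * x1 t)"
    define Y where "Y = (\<lambda>t. y t - \<epsilon> * y1 t)"
    define Z where "Z = (\<lambda>t. z t - z0 - \<epsilon> * z1 t)"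
    \<comment> \<open>The products of the perturbation \<open>v\<close> with the non-equilibrium
      parts of \<open>x\<close> and \<open>y\<close> are all that the linearisation omits.\<close>
    define f where "f = (\<lambda>t. - \<epsilon> * v t * (X t + \<epsilon> * x1 t))"
    define h where "h = (\<lambda>t. - 2 * \<epsilon> * v t * (Y t + \<epsilon> * y1 t))"
    have X': "(X has_real_derivative 2 * Y t) (at t)" for t
      unfolding X_def Y_def by (rule derivative_eq_intros x' x1' refl | simp)+
    have Y': "(Y has_real_derivative Z t - a * X t - g * Y t + f t) (at t)" for t
      unfolding X_def Y_def Z_def f_def v_def
      by (rule derivative_eq_intros y' y1' refl | simp add: z0 v_def algebra_simps)+
    have Z': "(Z has_real_derivative - 2 * a * Y t - 2 * g * Z t + h t) (at t)" for t
      unfolding Y_def Z_def h_def v_def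
      by (rule derivative_eq_intros z' z1' refl | simp add: algebra_simps)+
    have per1: "x1 (t + 2 * pi / w) = x1 t" "y1 (t + 2 * pi / w) = y1 t" "z1 (t + 2 * pi / w) = z1 t" for t
      unfolding x1_def y1_def z1_def by (rule Re_mult_cis_periodic, use w in simp)+
    have perX: "X (t + 2 * pi / w) = X t" "Y (t + 2 * pi / w) = Y t" "Z (t + 2 * pi / w) = Z t" for t
      by (simp_all add: X_def Y_def Z_def per per1)
    have p: "2 * pi / w > 0" using w by simp
    have "continuous_on UNIV X" "continuous_on UNIV Y"
      by (rule DERIV_continuous_on[OF has_field_derivative_at_within], rule X' Y')+
    hence "continuous_on UNIV (\<lambda>t. \<bar>X t\<bar> + \<bar>Y t\<bar>)" by (intro continuous_intros)
    then obtain s where s: "\<And>t. \<bar>X t\<bar> + \<bar>Y t\<bar> \<le> \<bar>X s\<bar> + \<bar>Y s\<bar>"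
      using periodic_attains_max[OF p, of "\<lambda>t. \<bar>X t\<bar> + \<bar>Y t\<bar>"] perX by auto
    \<comment> \<open>The maximum of the remainder over a period, so far only known to be
      finite.\<close>
    define B where "B = \<bar>X s\<bar> + \<bar>Y s\<bar>"
    define F where "F = 2 * \<epsilon> * u * (B + \<epsilon> * k)"
    have v: "\<bar>v t\<bar> \<le> u" for t unfolding v_def u_def by (rule abs_Re_mult_cis_le)
    have x1: "\<bar>x1 t\<bar> \<le> k" and y1: "\<bar>y1 t\<bar> \<le> k" for t
      unfolding x1_def y1_def k_def
      using abs_Re_mult_cis_le[of xh "w * t"] abs_Re_mult_cis_le[of yh "w * t"]
        norm_ge_zero[of xh] norm_ge_zero[of yh] by linarith+
    have FX: "\<bar>2 * \<epsilon> * v t * (c + \<epsilon> * e)\<bar> \<le> F" if "\<bar>c\<bar> \<le> B" "\<bar>e\<bar> \<le> k" for t c e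
    proof -
      have "\<epsilon> * \<bar>e\<bar> \<le> \<epsilon> * k" using \<epsilon> that by (intro mult_left_mono) auto
      moreover have "\<bar>\<epsilon> * e\<bar> = \<epsilon> * \<bar>e\<bar>" using \<epsilon> by (simp add: abs_mult)
      ultimately have "\<bar>c + \<epsilon> * e\<bar> \<le> B + \<epsilon> * k"
        using abs_triangle_ineq[of c "\<epsilon> * e"] that by linarith
      moreover have "2 * \<epsilon> * \<bar>v t\<bar> \<le> 2 * \<epsilon> * u" using \<epsilon> v[of t] by simp
      ultimately have "2 * \<epsilon> * \<bar>v t\<bar> * \<bar>c + \<epsilon> * e\<bar> \<le> F"
        unfolding F_def using \<epsilon> u by (intro mult_mono) auto
      thus ?thesis using \<epsilon> by (simp add: abs_mult)
    qed
    have XY: "\<bar>X t\<bar> \<le> B" "\<bar>Y t\<bar> \<le> B" for t using s[of t] by (auto simp: B_def)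
    have h: "\<bar>h t\<bar> \<le> F" for t
      using FX[OF XY(2) y1, of t t t] by (simp add: h_def abs_mult)
    have f: "\<bar>f t\<bar> \<le> F" for t
    proof -
      have "2 * \<bar>f t\<bar> \<le> F" using FX[OF XY(1) x1, of t t t] by (simp add: f_def abs_mult)
      thus ?thesis by linarith
    qed
    note bound = bound[OF p perX X' Y' Z' f h]
    \<comment> \<open>Since \<open>F\<close> itself contains \<open>B\<close>, this is a
      self-consistent inequality: the coefficient of \<open>B\<close> on the right is at most 1/2,
      so that term moves to the left.\<close>
    have "B \<le> 2 * (K * F)" using bound[of s] by (simp add: B_def)
    also have "\<dots> = (4 * K * u * \<epsilon>) * B + 4 * K * u * k * \<epsilon>\<^sup>2"
      by (simp add: F_def power2_eq_square algebra_simps)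
    also have "4 * K * u * \<epsilon> \<le> 1 / 2"
    proof -
      have "8 * K * (u + 1) > 0" using K u by simp
      hence "\<epsilon> * (8 * K * (u + 1)) < 1"
        using \<epsilon>(2) unfolding \<epsilon>\<^sub>0_def by (simp only: pos_less_divide_eq)
      moreover have "8 * K * u * \<epsilon> \<le> 8 * K * (u + 1) * \<epsilon>" using \<epsilon> K u by simp
      ultimately show ?thesis 
        by (simp add: mult_ac)
    qed
    hence "(4 * K * u * \<epsilon>) * B \<le> 1 / 2 * B" by (rule mult_right_mono) (simp add: B_def)
    finally have "B \<le> 8 * K * u * k * \<epsilon>\<^sup>2" by simp
    moreover have "8 * K * u * k * \<epsilon>\<^sup>2 = (8 * K * u * \<epsilon>) * (\<epsilon> * k)" by (simp add: power2_eq_square)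
    moreover have "(8 * K * u * \<epsilon>) * (\<epsilon> * k) \<le> 1 * (\<epsilon> * k)"
      using \<open>4 * K * u * \<epsilon> \<le> 1 / 2\<close> \<epsilon> k by (intro mult_right_mono) auto
    \<comment> \<open>This crude bound suffices, because \<open>F\<close> carries another factor
      \<epsilon>.\<close>
    ultimately have "B \<le> \<epsilon> * k" by simp
    hence "2 * \<epsilon> * u * (B + \<epsilon> * k) \<le> 2 * \<epsilon> * u * (\<epsilon> * k + \<epsilon> * k)"
      using \<epsilon> u by (intro mult_left_mono) auto
    hence "F \<le> 4 * u * k * \<epsilon>\<^sup>2" by (simp add: F_def power2_eq_square algebra_simps)
    hence "K * F \<le> C * \<epsilon>\<^sup>2" using K by (simp add: C_def)
    with bound[of t] have "\<bar>X t\<bar> \<le> C * \<epsilon>\<^sup>2 \<and> \<bar>Z t\<bar> \<le> C * \<epsilon>\<^sup>2" by auto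
    thus "\<bar>x t - x0 - \<epsilon> * Re (xh * cis (w * t))\<bar> \<le> C * \<epsilon>\<^sup>2 \<and>
      \<bar>z t - z0 - \<epsilon> * Re (zh * cis (w * t))\<bar> \<le> C * \<epsilon>\<^sup>2"
      by (simp only: X_def Z_def x1_def z1_def)
  qed
qed

section \<open>From the matrix equation to three scalar equations\<close>

lemma periodic_covariance_entries:
  assumes "is_periodic_covariance m \<gamma> k\<^sub>B \<omega> q T S"
  shows "S (t + 2 * pi / \<omega>) = S t"
    and "((\<lambda>t. S t $ 1 $ 1) has_real_derivative 2 * S t $ 1 $ 2) (at t)"
    and "((\<lambda>t. S t $ 1 $ 2) has_real_derivative
           S t $ 2 $ 2 - q t / m * S t $ 1 $ 1 - \<gamma> / m * S t $ 1 $ 2) (at t)"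
    and "((\<lambda>t. S t $ 2 $ 2) has_real_derivative
           - 2 * (q t / m) * S t $ 1 $ 2 - 2 * (\<gamma> / m) * S t $ 2 $ 2 + 2 * \<gamma> * k\<^sub>B * T t / m\<^sup>2) (at t)"
proof -
  show "S (t + 2 * pi / \<omega>) = S t" using assms by (simp add: is_periodic_covariance_def)
  have "transpose (S t) = S t" using assms by (simp add: is_periodic_covariance_def)
  hence "transpose (S t) $ 1 $ 2 = S t $ 1 $ 2" by simp
  hence sym: "S t $ 2 $ 1 = S t $ 1 $ 2" by (simp add: transpose_def)
  let ?A = "drift_matrix m \<gamma> q t"
  have "(S has_vector_derivative (?A ** S t + S t ** transpose ?A + noise_matrix m \<gamma> k\<^sub>B T t)) (at t)"
    using assms by (simp add: is_periodic_covariance_def)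
  hence entry: "((\<lambda>t. S t $ i $ j) has_real_derivative
      (?A ** S t + S t ** transpose ?A + noise_matrix m \<gamma> k\<^sub>B T t) $ i $ j) (at t)" for i j
    unfolding has_real_derivative_iff_has_vector_derivative
    by (intro bounded_linear.has_vector_derivative[OF bounded_linear_vec_nth])
  show "((\<lambda>t. S t $ 1 $ 1) has_real_derivative 2 * S t $ 1 $ 2) (at t)"
    using entry[of 1 1]
    by (simp add: matrix_matrix_mult_def transpose_def drift_matrix_def noise_matrix_def sum_2 sym)
  show "((\<lambda>t. S t $ 1 $ 2) has_real_derivative
           S t $ 2 $ 2 - q t / m * S t $ 1 $ 1 - \<gamma> / m * S t $ 1 $ 2) (at t)"
    using entry[of 1 2]
    by (simp add: matrix_matrix_mult_def transpose_def drift_matrix_def noise_matrix_def sum_2 sym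
        algebra_simps)
  show "((\<lambda>t. S t $ 2 $ 2) has_real_derivative
           - 2 * (q t / m) * S t $ 1 $ 2 - 2 * (\<gamma> / m) * S t $ 2 $ 2 + 2 * \<gamma> * k\<^sub>B * T t / m\<^sup>2) (at t)"
    using entry[of 2 2]
    by (simp add: matrix_matrix_mult_def transpose_def drift_matrix_def noise_matrix_def sum_2 sym
        algebra_simps)
qed

subsection \<open>The response to the optimal control\<close>

text \<open>All negative terms cancel on expansion. Positivity also shows that \<alpha> and \<beta>
  do not both vanish.\<close>

lemma power_denominator_pos:
  fixes m \<gamma> \<omega> q\<^sub>0 \<alpha> \<beta> :: real
  assumes "m > 0" "\<gamma> > 0" "\<omega> > 0" "q\<^sub>0 > 0"
    and "\<alpha> = 4 * q\<^sub>0 * \<gamma> - 3 * \<omega>\<^sup>2 * \<gamma> * m"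
    and "\<beta> = \<omega> * (2 * \<gamma>\<^sup>2 + 4 * q\<^sub>0 * m - \<omega>\<^sup>2 * m\<^sup>2)"
  shows "2 * \<gamma> * \<beta> - \<alpha> * \<omega> * m > 0"
proof -
  have "2 * \<gamma> * \<beta> - \<alpha> * \<omega> * m = \<omega> * \<gamma> * (4 * \<gamma>\<^sup>2 + 4 * q\<^sub>0 * m + \<omega>\<^sup>2 * m\<^sup>2)"
    unfolding assms(5,6) by (simp add: algebra_simps power2_eq_square)
  also have "\<dots> > 0" using assms(1-4) by (intro mult_pos_pos add_pos_pos) auto
  finally show ?thesis .
qed

text \<open>\<open>Complex \<alpha> \<beta>\<close> is \<open>m\<^sup>2\<close> times the
  characteristic polynomial of the linearised system at \<open>\<i> * \<omega>\<close>, so dividing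
  by it solves for the amplitudes. The last two conclusions supply the work and the amplitude of the
  heat rate.\<close>

lemma optimal_response:
  fixes m \<gamma> k\<^sub>B \<omega> q\<^sub>0 T\<^sub>0 T\<^sub>1 \<alpha> \<beta> d c :: real
  assumes pos: "m > 0" "\<gamma> > 0" "k\<^sub>B > 0" "\<omega> > 0" "q\<^sub>0 > 0" "T\<^sub>0 > 0" "T\<^sub>1 > 0"
    and \<alpha>: "\<alpha> = 4 * q\<^sub>0 * \<gamma> - 3 * \<omega>\<^sup>2 * \<gamma> * m"
    and \<beta>: "\<beta> = \<omega> * (2 * \<gamma>\<^sup>2 + 4 * q\<^sub>0 * m - \<omega>\<^sup>2 * m\<^sup>2)"
    and d: "d = 2 * \<gamma> * \<beta> - \<alpha> * \<omega> * m"
    and c: "c = q\<^sub>0 * \<gamma> * T\<^sub>1 / (T\<^sub>0 * d)"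
  obtains xh yh zh :: complex where
    "\<i> * \<omega> * xh = 2 * yh"
    "\<i> * \<omega> * yh = zh - (q\<^sub>0 / m) * xh - (\<gamma> / m) * yh - (k\<^sub>B * T\<^sub>0 / q\<^sub>0) * (c / m * Complex \<beta> \<alpha>)"
    "\<i> * \<omega> * zh = - 2 * (q\<^sub>0 / m) * yh - 2 * (\<gamma> / m) * zh + (2 * \<gamma> * k\<^sub>B * T\<^sub>1 / m\<^sup>2)"
    "Im (c * Complex \<beta> \<alpha> * cnj xh) = 2 * c * k\<^sub>B * \<gamma> * T\<^sub>1"
    "k\<^sub>B * T\<^sub>1 / m - zh = k\<^sub>B * T\<^sub>1 / m *
       (1 - 2 * m * \<gamma> * Complex (2 * q\<^sub>0 / m - \<omega>\<^sup>2) (\<omega> * \<gamma> / m) / Complex \<alpha> \<beta>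
          + 2 * m * \<gamma> * q\<^sub>0 * \<omega> / d * Complex \<alpha> (- \<beta>) / Complex \<alpha> \<beta>)"
proof -
  have "d > 0" using power_denominator_pos[OF pos(1,2,4,5) \<alpha> \<beta>] d by simp
  define P where "P = Complex \<alpha> \<beta>"
  define R where "R = Complex (2 * q\<^sub>0 / m - \<omega>\<^sup>2) (\<omega> * \<gamma> / m)"
  have "P \<noteq> 0"
  proof
    assume "P = 0"
    hence "\<alpha> = 0" "\<beta> = 0" by (simp_all add: P_def complex_eq_iff)
    thus False using \<open>d > 0\<close> d by simp
  qed
  have U: "Complex \<beta> \<alpha> = \<i> * cnj P" by (simp add: P_def complex_eq_iff)
  have P: "P = m\<^sup>2 * ((2 * \<gamma> / m + \<i> * \<omega>) * R + 2 * \<i> * \<omega> * (q\<^sub>0 / m))"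
    using pos by (simp add: P_def R_def \<alpha> \<beta> complex_eq_iff field_simps power2_eq_square)
  define W :: complex where "W = (k\<^sub>B * T\<^sub>0 / q\<^sub>0) * (c / m * Complex \<beta> \<alpha>)"
  define xh where "xh = 2 * m\<^sup>2 / P * (2 * \<gamma> * k\<^sub>B * T\<^sub>1 / m\<^sup>2
      - (2 * \<gamma> / m + \<i> * \<omega>) * W)"
  define yh where "yh = \<i> * \<omega> * xh / 2"
  \<comment> \<open>Eliminating \<open>yh\<close> from the second equation gives this form; the
    third equation then determines \<open>xh\<close>.\<close>
  define zh where "zh = R / 2 * xh + W"
  show thesis
  proof (rule that)
    show "\<i> * \<omega> * xh = 2 * yh" by (simp add: yh_def)
    have Rh: "R / 2 = (\<i> * \<omega>) * (\<i> * \<omega> + \<gamma> / m) / 2 + q\<^sub>0 / m"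
      using pos by (simp add: R_def complex_eq_iff field_simps power2_eq_square)
    show "\<i> * \<omega> * yh = zh - (q\<^sub>0 / m) * xh - (\<gamma> / m) * yh - (k\<^sub>B * T\<^sub>0 / q\<^sub>0) * (c / m * Complex \<beta> \<alpha>)"
      unfolding zh_def yh_def Rh W_def[symmetric] using pos by (simp add: field_simps)
    have xP: "P * xh = 2 * m\<^sup>2 * (2 * \<gamma> * k\<^sub>B * T\<^sub>1 / m\<^sup>2
      - (2 * \<gamma> / m + \<i> * \<omega>) * W)"
      using \<open>P \<noteq> 0\<close> by (simp add: xh_def)
    have "(2 * \<gamma> / m + \<i> * \<omega>) * (R / 2 * xh) + \<i> * \<omega> * (q\<^sub>0 / m) * xh = P * xh / (2 * m\<^sup>2)"
      unfolding P using pos by (simp add: field_simps)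
    also have "\<dots> = 2 * \<gamma> * k\<^sub>B * T\<^sub>1 / m\<^sup>2
      - (2 * \<gamma> / m + \<i> * \<omega>) * W"
      unfolding xP using pos by (simp add: field_simps)
    finally have "(2 * \<gamma> / m + \<i> * \<omega>) * zh = - \<i> * \<omega> * (q\<^sub>0 / m) * xh + 2 * \<gamma> * k\<^sub>B * T\<^sub>1 / m\<^sup>2"
      unfolding zh_def by (simp add: algebra_simps add_divide_distrib)
    thus "\<i> * \<omega> * zh = - 2 * (q\<^sub>0 / m) * yh - 2 * (\<gamma> / m) * zh + (2 * \<gamma> * k\<^sub>B * T\<^sub>1 / m\<^sup>2)"
      unfolding yh_def by (simp add: algebra_simps add_divide_distrib)
    \<comment> \<open>The value of \<open>c\<close> makes the quadratic loss half of the linear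
      gain, as at the vertex of a parabola.\<close>
    have cd: "k\<^sub>B * T\<^sub>0 / q\<^sub>0 * c * d = \<gamma> * k\<^sub>B * T\<^sub>1"
      using pos \<open>d > 0\<close> by (simp add: c)
    \<comment> \<open>The phase of the control makes this a real multiple of
      \<open>P\<close>.\<close>
    have cW: "\<i> * cnj W = (k\<^sub>B * T\<^sub>0 / q\<^sub>0) * (c / m) * P"
      by (simp add: W_def U mult_ac)
    have "c * Complex \<beta> \<alpha> * cnj xh = c * \<i> * cnj (P * xh)"
      by (simp add: U)
    also have "\<dots> = 2 * m\<^sup>2 * c * (\<i> * (2 * \<gamma> * k\<^sub>B * T\<^sub>1 / m\<^sup>2)
      - (2 * \<gamma> / m - \<i> * \<omega>) * (\<i> * cnj W))"
      unfolding xP by (simp add: algebra_simps)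
    also have "\<dots> = 2 * m\<^sup>2 * c * (\<i> * (2 * \<gamma> * k\<^sub>B * T\<^sub>1 / m\<^sup>2)
      - (2 * \<gamma> / m - \<i> * \<omega>) * ((k\<^sub>B * T\<^sub>0 / q\<^sub>0) * (c / m) * P))"
      unfolding cW ..
    also have "Im \<dots> = 2 * m\<^sup>2 * c * (2 * \<gamma> * k\<^sub>B * T\<^sub>1 / m\<^sup>2 - k\<^sub>B * T\<^sub>0 / q\<^sub>0 * c * d / m\<^sup>2)"
      using pos by (simp add: d P_def field_simps power2_eq_square)
    also have "\<dots> = 2 * c * k\<^sub>B * \<gamma> * T\<^sub>1" unfolding cd using pos by (simp add: field_simps)
    finally show "Im (c * Complex \<beta> \<alpha> * cnj xh) = 2 * c * k\<^sub>B * \<gamma> * T\<^sub>1" .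
    have cP: "Complex \<alpha> (- \<beta>) = cnj P" by (simp add: P_def complex_eq_iff)
    have "P * zh = R / 2 * (P * xh) + P * W"
      by (simp add: zh_def algebra_simps)
    also have "\<dots> = 2 * \<gamma> * k\<^sub>B * T\<^sub>1 * R
      + (P - m\<^sup>2 * ((2 * \<gamma> / m + \<i> * \<omega>) * R)) * W"
      unfolding xP using pos by (simp add: field_simps)
    also have "P - m\<^sup>2 * ((2 * \<gamma> / m + \<i> * \<omega>) * R) = m\<^sup>2 * (2 * \<i> * \<omega> * (q\<^sub>0 / m))"
      by (subst P) (simp add: distrib_left)
    also have "m\<^sup>2 * (2 * \<i> * \<omega> * (q\<^sub>0 / m)) * W
      = - (2 * \<omega> * k\<^sub>B * T\<^sub>0 * c * cnj P)"
      unfolding W_def U using pos by (simp add: field_simps power2_eq_square)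
    finally have "zh = (2 * \<gamma> * k\<^sub>B * T\<^sub>1 * R - 2 * \<omega> * k\<^sub>B * T\<^sub>0 * c * cnj P) / P"
      using \<open>P \<noteq> 0\<close> by (simp add: field_simps)
    note zh = this
    show "k\<^sub>B * T\<^sub>1 / m - zh = k\<^sub>B * T\<^sub>1 / m *
       (1 - 2 * m * \<gamma> * Complex (2 * q\<^sub>0 / m - \<omega>\<^sup>2) (\<omega> * \<gamma> / m) / Complex \<alpha> \<beta>
          + 2 * m * \<gamma> * q\<^sub>0 * \<omega> / d * Complex \<alpha> (- \<beta>) / Complex \<alpha> \<beta>)"
      unfolding R_def[symmetric] P_def[symmetric] zh using pos \<open>d > 0\<close> \<open>P \<noteq> 0\<close>
      by (simp add: cP c field_simps)
  qed
qed

text \<open>Needed for \<kappa> > 0. If the amplitude vanished, its real and imaginary parts and the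
  definition of \<open>d\<close> would give three equations for \<open>K\<close>, which are
  incompatible for positive parameters.\<close>

lemma heat_amplitude_nonzero:
  fixes m \<gamma> \<omega> q\<^sub>0 \<alpha> \<beta> d :: real
  assumes pos: "m > 0" "\<gamma> > 0" "\<omega> > 0" "q\<^sub>0 > 0"
    and \<alpha>: "\<alpha> = 4 * q\<^sub>0 * \<gamma> - 3 * \<omega>\<^sup>2 * \<gamma> * m"
    and \<beta>: "\<beta> = \<omega> * (2 * \<gamma>\<^sup>2 + 4 * q\<^sub>0 * m - \<omega>\<^sup>2 * m\<^sup>2)"
    and d: "d = 2 * \<gamma> * \<beta> - \<alpha> * \<omega> * m"
  shows "1 - 2 * m * \<gamma> * Complex (2 * q\<^sub>0 / m - \<omega>\<^sup>2) (\<omega> * \<gamma> / m) / Complex \<alpha> \<beta>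
          + 2 * m * \<gamma> * q\<^sub>0 * \<omega> / d * Complex \<alpha> (- \<beta>) / Complex \<alpha> \<beta> \<noteq> 0"
proof
  assume 0: "1 - 2 * m * \<gamma> * Complex (2 * q\<^sub>0 / m - \<omega>\<^sup>2) (\<omega> * \<gamma> / m) / Complex \<alpha> \<beta>
          + 2 * m * \<gamma> * q\<^sub>0 * \<omega> / d * Complex \<alpha> (- \<beta>) / Complex \<alpha> \<beta> = 0"
  define K where "K = 2 * m * \<gamma> * q\<^sub>0 * \<omega> / d"
  have "d > 0" using power_denominator_pos[OF pos \<alpha> \<beta>] d by simp
  have "Complex \<alpha> \<beta> \<noteq> 0"
    using \<open>d > 0\<close> d by (auto simp: complex_eq_iff)
  hence "Complex \<alpha> \<beta> - 2 * m * \<gamma> * Complex (2 * q\<^sub>0 / m - \<omega>\<^sup>2) (\<omega> * \<gamma> / m)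
      + of_real K * Complex \<alpha> (- \<beta>) = 0"
    using 0 by (simp add: K_def field_simps)
  hence "\<alpha> - 2 * m * \<gamma> * (2 * q\<^sub>0 / m - \<omega>\<^sup>2) + K * \<alpha> = 0"
    and "\<beta> - 2 * m * \<gamma> * (\<omega> * \<gamma> / m) - K * \<beta> = 0"
    by (simp_all add: complex_eq_iff)
  \<comment> \<open>In these variables \<open>\<alpha> = \<gamma> * (Q - 3 * s)\<close> and
    \<open>\<beta> = \<omega> * (2 * \<gamma>\<^sup>2 + m * (Q - s))\<close>.\<close>
  define s where "s = \<omega>\<^sup>2 * m"
  define Q where "Q = 4 * q\<^sub>0"
  have "s > 0" using pos by (simp add: s_def)
  have "Q > 0" using pos by (simp add: Q_def)
  have "K > 0" using pos \<open>d > 0\<close> by (simp add: K_def)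
  have "\<gamma> * (K * (Q - 3 * s) - s) = 0"
    using \<open>\<alpha> - 2 * m * \<gamma> * (2 * q\<^sub>0 / m - \<omega>\<^sup>2) + K * \<alpha> = 0\<close> pos unfolding \<alpha> s_def Q_def
    by (simp add: field_simps)
  hence K1: "K * (Q - 3 * s) = s" using pos by simp
  have "\<omega> * ((2 * \<gamma>\<^sup>2 + m * (Q - s)) * (1 - K) - 2 * \<gamma>\<^sup>2) = 0"
    using \<open>\<beta> - 2 * m * \<gamma> * (\<omega> * \<gamma> / m) - K * \<beta> = 0\<close> pos unfolding \<beta> s_def Q_def
    by (simp add: field_simps power2_eq_square)
  hence K2: "(2 * \<gamma>\<^sup>2 + m * (Q - s)) * (1 - K) = 2 * \<gamma>\<^sup>2" using pos by simp
  have "K * d = 2 * m * \<gamma> * q\<^sub>0 * \<omega>" using \<open>d > 0\<close> by (simp add: K_def)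
  hence "\<omega> * \<gamma> * (2 * K * (4 * \<gamma>\<^sup>2 + m * (Q + s)) - m * Q) = 0"
    unfolding d \<alpha> \<beta> s_def Q_def by (simp add: algebra_simps power2_eq_square)
  hence K3: "2 * K * (4 * \<gamma>\<^sup>2 + m * (Q + s)) = m * Q" using pos by simp
  \<comment> \<open>Eliminating \<open>K\<close> and then \<open>\<gamma>\<close> leaves a quadratic with the roots \<open>Q = 2 s\<close> and \<open>Q = 3 s\<close>,
      which contradict \<open>Q > 3 s\<close>.\<close>
  have "Q > 3 * s" using K1 \<open>s > 0\<close> \<open>K > 0\<close> by (metis diff_gt_0_iff_gt zero_less_mult_pos)
  have E2: "m * (Q - s) * (Q - 4 * s) = 2 * \<gamma>\<^sup>2 * s"
  proof -
    have "(2 * \<gamma>\<^sup>2 + m * (Q - s)) * ((Q - 3 * s) - K * (Q - 3 * s)) = 2 * \<gamma>\<^sup>2 * (Q - 3 * s)"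
      using arg_cong[OF K2, of "\<lambda>v. v * (Q - 3 * s)"] by (simp add: algebra_simps)
    thus ?thesis unfolding K1 by (simp add: algebra_simps)
  qed
  have "2 * (K * (Q - 3 * s)) * (4 * \<gamma>\<^sup>2 + m * (Q + s)) = m * Q * (Q - 3 * s)"
    unfolding K3[symmetric] by simp
  hence "4 * (2 * \<gamma>\<^sup>2 * s) + 2 * s * m * (Q + s) = m * Q * (Q - 3 * s)"
    unfolding K1 by (simp add: algebra_simps)
  hence "m * (3 * (Q - 2 * s) * (Q - 3 * s)) = 0"
    unfolding E2[symmetric] by (simp add: algebra_simps)
  hence "Q = 2 * s \<or> Q = 3 * s" using pos by simp
  thus False using \<open>Q > 3 * s\<close> \<open>s > 0\<close> by linarith
qed

text \<open>Since \<open>Complex \<alpha> \<beta> = \<i> * Complex \<beta> (- \<alpha>)\<close>, its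
  argument is a quarter turn ahead of \<phi>. This links the rational form of the amplitude to the
  trigonometric form that specifies \<kappa>.\<close>

lemma heat_amplitude_polar:
  fixes \<alpha> \<beta> r \<phi> k \<kappa>\<^sub>2 :: real and R :: complex
  assumes "\<alpha> \<noteq> 0 \<or> \<beta> \<noteq> 0"
    and r: "r = cmod (Complex \<beta> (- \<alpha>))" and \<phi>: "\<phi> = Arg (Complex \<beta> (- \<alpha>))"
  shows "(cmod (1 - of_real k * R / Complex \<alpha> \<beta> + of_real \<kappa>\<^sub>2 * Complex \<alpha> (- \<beta>) / Complex \<alpha> \<beta>))\<^sup>2
    = (1 - (k * cmod R / r) * sin (Arg R - \<phi>) - \<kappa>\<^sub>2 * cos (2 * \<phi>))\<^sup>2
      + (- (k * cmod R / r) * cos (Arg R - \<phi>) - \<kappa>\<^sub>2 * sin (2 * \<phi>))\<^sup>2"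
proof -
  have "r > 0" using assms by (auto simp: r complex_eq_iff)
  have P': "Complex \<beta> (- \<alpha>) = r * cis \<phi>" unfolding r \<phi>
    by (metis rcis_cmod_Arg rcis_def)
  have P: "Complex \<alpha> \<beta> = \<i> * (r * cis \<phi>)"
    unfolding P'[symmetric] by (simp add: complex_eq_iff)
  have "Complex \<alpha> (- \<beta>) = cnj (Complex \<alpha> \<beta>)" by (simp add: complex_eq_iff)
  hence cP: "Complex \<alpha> (- \<beta>) = - \<i> * (r * cis (- \<phi>))"
    unfolding P by (simp add: cis_cnj)
  have R: "R = cmod R * cis (Arg R)" by (metis rcis_cmod_Arg rcis_def)
  have 1: "of_real k * R / Complex \<alpha> \<beta> = - \<i> * of_real (k * cmod R / r) * cis (Arg R - \<phi>)"
    unfolding P by (subst R) (use \<open>r > 0\<close> in \<open>simp add: cis_divide[symmetric] field_simps\<close>)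
  have 2: "of_real \<kappa>\<^sub>2 * Complex \<alpha> (- \<beta>) / Complex \<alpha> \<beta> = - of_real \<kappa>\<^sub>2 * cis (- 2 * \<phi>)"
  proof -
    have "cis (- 2 * \<phi>) = cis (- \<phi>) / cis \<phi>" by (simp add: cis_divide)
    thus ?thesis unfolding cP P using \<open>r > 0\<close> by (simp add: field_simps)
  qed
  show ?thesis unfolding 1 2 by (simp add: cmod_power2) (simp add: power2_eq_square algebra_simps)
qed

subsection \<open>Heat, work and efficiency\<close>

lemma integral_approx:
  fixes f g :: "real \<Rightarrow> real"
  assumes "continuous_on UNIV f" and g: "(g has_integral I) {0..p}"
    and B: "\<And>t. \<bar>f t - g t\<bar> \<le> B" and "p \<ge> 0"
  shows "\<bar>integral {0..p} f - I\<bar> \<le> B * p"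
proof -
  have "f integrable_on {0..p}"
    by (rule integrable_continuous_real) (rule continuous_on_subset[OF assms(1)], simp)
  hence "((\<lambda>t. f t - g t) has_integral integral {0..p} f - I) {0..p}"
    by (intro has_integral_diff integrable_integral g)
  moreover have "0 \<le> B" using B[of 0] by linarith
  ultimately show ?thesis
    using has_integral_bound_real[of B "{}" "\<lambda>t. f t - g t" _ 0 p] B \<open>p \<ge> 0\<close> by simp
qed

text \<open>Both relative errors are of order \<epsilon>, and the leading term of the quotient is
  itself of order \<epsilon>.\<close>

lemma quotient_bigo:
  fixes W Q :: "real \<Rightarrow> real"
  assumes W: "(\<lambda>\<epsilon>. W \<epsilon> - w * \<epsilon>\<^sup>2) \<in> O[at_right 0](\<lambda>\<epsilon>. \<epsilon> ^ 3)"
    and Q: "(\<lambda>\<epsilon>. Q \<epsilon> - \<epsilon> * k) \<in> O[at_right 0](\<lambda>\<epsilon>. \<epsilon>\<^sup>2)" and k: "k > 0"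
  shows "(\<lambda>\<epsilon>. W \<epsilon> / Q \<epsilon> - \<epsilon> * (w / k)) \<in> O[at_right 0](\<lambda>\<epsilon>. \<epsilon>\<^sup>2)"
proof -
  obtain c1 where c1: "c1 > 0" "\<forall>\<^sub>F \<epsilon> in at_right 0. \<bar>W \<epsilon> - w * \<epsilon>\<^sup>2\<bar> \<le> c1 * \<bar>\<epsilon> ^ 3\<bar>"
    using landau_o.bigE[OF W] by auto
  obtain c2 where c2: "c2 > 0" "\<forall>\<^sub>F \<epsilon> in at_right 0. \<bar>Q \<epsilon> - \<epsilon> * k\<bar> \<le> c2 * \<bar>\<epsilon>\<^sup>2\<bar>"
    using landau_o.bigE[OF Q] by auto
  \<comment> \<open>For such \<epsilon> the error of \<open>Q\<close> is at most half of its leading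
    term, which keeps the denominator away from zero.\<close>
  have "k / (2 * c2) > 0" using k c2 by simp
  hence "\<forall>\<^sub>F \<epsilon> in at_right 0. \<epsilon> \<in> {0<..<k / (2 * c2)}" by (rule eventually_at_right_real)
  with c1(2) c2(2)
  have "\<forall>\<^sub>F \<epsilon> in at_right 0. norm (W \<epsilon> / Q \<epsilon> - \<epsilon> * (w / k)) \<le> (2 * (k * c1 + \<bar>w\<bar> * c2) / k\<^sup>2) * norm (\<epsilon>\<^sup>2)"
  proof eventually_elim
    case (elim \<epsilon>)
    hence \<epsilon>: "\<epsilon> > 0" "2 * c2 * \<epsilon> < k" using c2 by (auto simp: field_simps)
    have "(2 * c2 * \<epsilon>) * \<epsilon> \<le> k * \<epsilon>" using \<epsilon> by (intro mult_right_mono) auto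
    hence "c2 * \<epsilon>\<^sup>2 \<le> k * \<epsilon> / 2" by (simp add: power2_eq_square)
    hence Q2: "k * \<epsilon> / 2 \<le> Q \<epsilon>" using elim(2) by (simp add: mult.commute)
    have "k * \<epsilon> / 2 > 0" using k \<epsilon> by simp
    hence Q0: "Q \<epsilon> > 0" using Q2 by linarith
    have "\<bar>k * (W \<epsilon> - w * \<epsilon>\<^sup>2) - w * \<epsilon> * (Q \<epsilon> - \<epsilon> * k)\<bar>
        \<le> \<bar>k * (W \<epsilon> - w * \<epsilon>\<^sup>2)\<bar> + \<bar>w * \<epsilon> * (Q \<epsilon> - \<epsilon> * k)\<bar>" by (rule abs_triangle_ineq4)
    also have "\<dots> \<le> k * (c1 * \<epsilon> ^ 3) + (\<bar>w\<bar> * \<epsilon>) * (c2 * \<epsilon>\<^sup>2)"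
      unfolding abs_mult using elim(1,2) \<epsilon> k by (intro add_mono mult_mono) (auto simp: abs_mult)
    also have "\<dots> = (k * c1 + \<bar>w\<bar> * c2) * \<epsilon> ^ 3" by (simp add: power2_eq_square power3_eq_cube algebra_simps)
    finally have num: "\<bar>k * (W \<epsilon> - w * \<epsilon>\<^sup>2) - w * \<epsilon> * (Q \<epsilon> - \<epsilon> * k)\<bar> \<le> (k * c1 + \<bar>w\<bar> * c2) * \<epsilon> ^ 3" .
    have "W \<epsilon> / Q \<epsilon> - \<epsilon> * (w / k) = (k * (W \<epsilon> - w * \<epsilon>\<^sup>2) - w * \<epsilon> * (Q \<epsilon> - \<epsilon> * k)) / (k * Q \<epsilon>)"
      using Q0 k by (simp add: field_simps power2_eq_square)
    hence "\<bar>W \<epsilon> / Q \<epsilon> - \<epsilon> * (w / k)\<bar> = \<bar>k * (W \<epsilon> - w * \<epsilon>\<^sup>2) - w * \<epsilon> * (Q \<epsilon> - \<epsilon> * k)\<bar> / (k * Q \<epsilon>)"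
      using Q0 k by (simp add: abs_divide abs_mult)
    also have "\<dots> \<le> ((k * c1 + \<bar>w\<bar> * c2) * \<epsilon> ^ 3) / (k * (k * \<epsilon> / 2))"
      using num Q2 k \<epsilon> c1(1) c2(1) by (intro frac_le) auto
    also have "\<dots> = (2 * (k * c1 + \<bar>w\<bar> * c2) / k\<^sup>2) * \<epsilon>\<^sup>2"
      using k \<epsilon> by (simp add: field_simps power2_eq_square power3_eq_cube)
    finally show ?case by simp
  qed
  thus ?thesis by (rule bigoI)
qed

theorem mainTheorem4:
  fixes m \<gamma> k\<^sub>B \<omega> q\<^sub>0 T\<^sub>0 T\<^sub>1 :: real
    and \<alpha> \<beta> r r\<^sub>2 \<theta> \<phi> \<kappa>\<^sub>1 \<kappa>\<^sub>2 \<kappa> q\<^sub>1 :: real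
    and u :: "real \<Rightarrow> real"
    and T q :: "real \<Rightarrow> real \<Rightarrow> real"
    and \<Sigma> :: "real \<Rightarrow> real \<Rightarrow> real^2^2"
  assumes "m > 0" "\<gamma> > 0" "k\<^sub>B > 0" "\<omega> > 0" "q\<^sub>0 > 0"
    and "T\<^sub>0 > T\<^sub>1" "T\<^sub>1 > 0"
    and "\<alpha> = 4 * q\<^sub>0 * \<gamma> - 3 * \<omega>\<^sup>2 * \<gamma> * m"
    and "\<beta> = \<omega> * (2 * \<gamma>\<^sup>2 + 4 * q\<^sub>0 * m - \<omega>\<^sup>2 * m\<^sup>2)"
    and "r = sqrt (\<alpha>\<^sup>2 + \<beta>\<^sup>2)"
    and "r\<^sub>2 = sqrt ((2 * q\<^sub>0 / m - \<omega>\<^sup>2)\<^sup>2 + (\<omega> * \<gamma> / m)\<^sup>2)"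
    and "\<theta> = Arg (Complex (2 * q\<^sub>0 / m - \<omega>\<^sup>2) (\<omega> * \<gamma> / m))"
    and "\<phi> = Arg (Complex \<beta> (- \<alpha>))"
    and "\<kappa>\<^sub>1 = 2 * m * \<gamma> * r\<^sub>2 / r"
    and "\<kappa>\<^sub>2 = 2 * m * \<gamma> * q\<^sub>0 * \<omega> / (2 * \<gamma> * \<beta> - m * \<omega> * \<alpha>)"
    and "\<kappa> \<ge> 0"
    and "\<kappa>\<^sup>2 = (1 - \<kappa>\<^sub>1 * sin (\<theta> - \<phi>) - \<kappa>\<^sub>2 * cos (2 * \<phi>))\<^sup>2
             + (- \<kappa>\<^sub>1 * cos (\<theta> - \<phi>) - \<kappa>\<^sub>2 * sin (2 * \<phi>))\<^sup>2"
    and "q\<^sub>1 = q\<^sub>0 * \<gamma> * T\<^sub>1 * sqrt (\<alpha>\<^sup>2 + \<beta>\<^sup>2) / (T\<^sub>0 * (2 * \<gamma> * \<beta> - \<alpha> * \<omega> * m))"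
    and "\<And>t. u t = q\<^sub>1 * cos (\<omega> * t - \<phi>)"
    and "\<And>\<epsilon> t. T \<epsilon> t = T\<^sub>0 + \<epsilon> * T\<^sub>1 * cos (\<omega> * t)"
    and "\<And>\<epsilon> t. q \<epsilon> t = q\<^sub>0 + \<epsilon> * u t"
    and "\<forall>\<^sub>F \<epsilon> in at_right 0. is_periodic_covariance m \<gamma> k\<^sub>B \<omega> (q \<epsilon>) (T \<epsilon>) (\<Sigma> \<epsilon>)"
  shows "(\<lambda>\<epsilon>. heat_intake m \<gamma> k\<^sub>B \<omega> (T \<epsilon>) (\<Sigma> \<epsilon>)
              - \<epsilon> * (2 * \<kappa> * \<gamma> * k\<^sub>B * T\<^sub>1 / (m * \<omega>)))
           \<in> O[at_right 0](\<lambda>\<epsilon>. \<epsilon>\<^sup>2)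
       \<and> (\<lambda>\<epsilon>. efficiency m \<gamma> k\<^sub>B \<omega> (q \<epsilon>) (T \<epsilon>) (\<Sigma> \<epsilon>)
              - \<epsilon> * (pi * m * \<omega> * q\<^sub>0 * \<gamma> * T\<^sub>1
                       / (2 * \<kappa> * T\<^sub>0 * (2 * \<gamma> * \<beta> - \<alpha> * \<omega> * m))))
           \<in> O[at_right 0](\<lambda>\<epsilon>. \<epsilon>\<^sup>2)"
proof -
  have pos: "m > 0" "\<gamma> > 0" "k\<^sub>B > 0" "\<omega> > 0" "q\<^sub>0 > 0" "T\<^sub>0 > 0" "T\<^sub>1 > 0"
    using assms(1-7) by auto
  note \<alpha> = assms(8) and \<beta> = assms(9) and T = assms(20) and q = assms(21)
  define d where "d = 2 * \<gamma> * \<beta> - \<alpha> * \<omega> * m"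
  have "d > 0" unfolding d_def by (rule power_denominator_pos[OF pos(1,2,4,5) \<alpha> \<beta>])
  define c where "c = q\<^sub>0 * \<gamma> * T\<^sub>1 / (T\<^sub>0 * d)"
  define U where "U = c * Complex \<beta> \<alpha>"
  have \<alpha>\<beta>: "\<alpha> \<noteq> 0 \<or> \<beta> \<noteq> 0" using \<open>d > 0\<close> by (auto simp: d_def)
  obtain xh yh zh :: complex where
    xh: "\<i> * \<omega> * xh = 2 * yh"
    and yh: "\<i> * \<omega> * yh = zh - (q\<^sub>0 / m) * xh - (\<gamma> / m) * yh - (k\<^sub>B * T\<^sub>0 / q\<^sub>0) * (c / m * Complex \<beta> \<alpha>)"
    and zh: "\<i> * \<omega> * zh = - 2 * (q\<^sub>0 / m) * yh - 2 * (\<gamma> / m) * zh + (2 * \<gamma> * k\<^sub>B * T\<^sub>1 / m\<^sup>2)"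
    and power: "Im (c * Complex \<beta> \<alpha> * cnj xh) = 2 * c * k\<^sub>B * \<gamma> * T\<^sub>1"
    and heat: "k\<^sub>B * T\<^sub>1 / m - zh = k\<^sub>B * T\<^sub>1 / m *
       (1 - 2 * m * \<gamma> * Complex (2 * q\<^sub>0 / m - \<omega>\<^sup>2) (\<omega> * \<gamma> / m) / Complex \<alpha> \<beta>
          + 2 * m * \<gamma> * q\<^sub>0 * \<omega> / d * Complex \<alpha> (- \<beta>) / Complex \<alpha> \<beta>)"
    by (rule optimal_response[OF pos \<alpha> \<beta> d_def c_def]) blast

  define H where "H = k\<^sub>B * T\<^sub>1 / m - zh"
  define h where "h = 1 - 2 * m * \<gamma> * Complex (2 * q\<^sub>0 / m - \<omega>\<^sup>2) (\<omega> * \<gamma> / m) / Complex \<alpha> \<beta>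
          + 2 * m * \<gamma> * q\<^sub>0 * \<omega> / d * Complex \<alpha> (- \<beta>) / Complex \<alpha> \<beta>"
  have "h \<noteq> 0" unfolding h_def by (rule heat_amplitude_nonzero[OF pos(1,2,4,5) \<alpha> \<beta> d_def])
  have r: "r = cmod (Complex \<beta> (- \<alpha>))" using assms(10) by (simp add: complex_norm add.commute)
  have "(cmod h)\<^sup>2 = \<kappa>\<^sup>2"
  proof -
    have r2: "r\<^sub>2 = cmod (Complex (2 * q\<^sub>0 / m - \<omega>\<^sup>2) (\<omega> * \<gamma> / m))"
      using assms(11) by (simp add: complex_norm)
    have k2: "2 * m * \<gamma> * q\<^sub>0 * \<omega> / d = \<kappa>\<^sub>2" using assms(15) by (simp add: d_def mult_ac)
    have "h = 1 - of_real (2 * m * \<gamma>) * Complex (2 * q\<^sub>0 / m - \<omega>\<^sup>2) (\<omega> * \<gamma> / m) / Complex \<alpha> \<beta>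
          + of_real \<kappa>\<^sub>2 * Complex \<alpha> (- \<beta>) / Complex \<alpha> \<beta>"
      by (simp add: h_def flip: k2)
    thus ?thesis
      using heat_amplitude_polar[OF \<alpha>\<beta> r assms(13), of "2 * m * \<gamma>"
          "Complex (2 * q\<^sub>0 / m - \<omega>\<^sup>2) (\<omega> * \<gamma> / m)" \<kappa>\<^sub>2]
      by (simp only: assms(17,14,12) r2)
  qed
  hence \<kappa>: "cmod h = \<kappa>" using assms(16) by (metis norm_ge_zero power2_eq_iff_nonneg)
  with \<open>h \<noteq> 0\<close> have "\<kappa> > 0" by auto
  \<comment> \<open>\<open>H\<close> is the first-order amplitude of the heat rate divided by
    \<gamma>, and \<open>h\<close> is its dimensionless form.\<close>
  have cmod_H: "cmod H = k\<^sub>B * T\<^sub>1 / m * \<kappa>"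
  proof -
    have "H = of_real (k\<^sub>B * T\<^sub>1 / m) * h" using heat by (simp add: H_def h_def)
    thus ?thesis using pos by (simp only: norm_mult norm_of_real \<kappa>) simp
  qed

  have u: "u t = Re (U * cis (\<omega> * t))" for t
  proof -
    have "Complex \<beta> (- \<alpha>) = r * cis \<phi>"
      unfolding r assms(13) by (metis rcis_cmod_Arg rcis_def)
    hence "cnj (Complex \<beta> (- \<alpha>)) = cnj (r * cis \<phi>)" by (rule arg_cong)
    hence "Complex \<beta> \<alpha> = r * cis (- \<phi>)" by (simp add: cis_cnj complex_eq_iff)
    moreover have "q\<^sub>1 = c * r" using assms(10,18) by (simp add: c_def d_def mult_ac)
    ultimately have "U * cis (\<omega> * t) = of_real q\<^sub>1 * cis (\<omega> * t - \<phi>)"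
      by (simp add: U_def cis_mult mult.assoc)
    thus ?thesis using assms(19) by simp
  qed

  define x0 where "x0 = k\<^sub>B * T\<^sub>0 / q\<^sub>0"
  define z0 where "z0 = k\<^sub>B * T\<^sub>0 / m"
  define a where "a = q\<^sub>0 / m"
  define g where "g = \<gamma> / m"
  define b where "b = 2 * \<gamma> * k\<^sub>B * T\<^sub>1 / m\<^sup>2"
  have ag: "a > 0" "g > 0" "z0 = a * x0" using pos by (simp_all add: a_def g_def z0_def x0_def)
  have yh': "\<i> * \<omega> * yh = zh - a * xh - g * yh - x0 * (U / m)"
    using yh by (simp add: a_def g_def x0_def U_def)
  have zh': "\<i> * \<omega> * zh = - 2 * a * yh - 2 * g * zh + b"
    using zh by (simp add: a_def g_def b_def)
  obtain C \<epsilon>\<^sub>0 where C: "C \<ge> 0" and \<epsilon>\<^sub>0: "\<epsilon>\<^sub>0 > 0"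
    and response: "\<And>\<epsilon> (x :: real \<Rightarrow> real) y z t. 0 < \<epsilon> \<Longrightarrow> \<epsilon> < \<epsilon>\<^sub>0 \<Longrightarrow>
      (\<And>t. x (t + 2 * pi / \<omega>) = x t) \<Longrightarrow> (\<And>t. y (t + 2 * pi / \<omega>) = y t) \<Longrightarrow>
      (\<And>t. z (t + 2 * pi / \<omega>) = z t) \<Longrightarrow>
      (\<And>t. (x has_real_derivative 2 * y t) (at t)) \<Longrightarrow>
      (\<And>t. (y has_real_derivative
         z t - (a + \<epsilon> * Re (U / m * cis (\<omega> * t))) * x t - g * y t) (at t)) \<Longrightarrow>
      (\<And>t. (z has_real_derivative
         - 2 * (a + \<epsilon> * Re (U / m * cis (\<omega> * t))) * y t - 2 * g * z t
         + 2 * g * z0 + \<epsilon> * b * cos (\<omega> * t)) (at t)) \<Longrightarrow>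
      \<bar>x t - x0 - \<epsilon> * Re (xh * cis (\<omega> * t))\<bar> \<le> C * \<epsilon>\<^sup>2 \<and>
      \<bar>z t - z0 - \<epsilon> * Re (zh * cis (\<omega> * t))\<bar> \<le> C * \<epsilon>\<^sup>2"
    by (rule linear_response[OF ag(1,2) pos(4) ag(3) xh yh' zh']) blast

  have "\<forall>\<^sub>F \<epsilon> in at_right 0. \<epsilon> \<in> {0<..<\<epsilon>\<^sub>0}" by (rule eventually_at_right_real[OF \<epsilon>\<^sub>0])
  with assms(22)
  have expansion: "\<forall>\<^sub>F \<epsilon> in at_right 0. \<epsilon> > 0 \<and>
      continuous_on UNIV (\<lambda>t. \<Sigma> \<epsilon> t $ 1 $ 1) \<and> continuous_on UNIV (\<lambda>t. \<Sigma> \<epsilon> t $ 2 $ 2) \<and>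
      (\<forall>t. \<bar>\<Sigma> \<epsilon> t $ 1 $ 1 - x0 - \<epsilon> * Re (xh * cis (\<omega> * t))\<bar> \<le> C * \<epsilon>\<^sup>2) \<and>
      (\<forall>t. \<bar>\<Sigma> \<epsilon> t $ 2 $ 2 - z0 - \<epsilon> * Re (zh * cis (\<omega> * t))\<bar> \<le> C * \<epsilon>\<^sup>2)"
  proof eventually_elim
    case (elim \<epsilon>)
    hence \<epsilon>: "0 < \<epsilon>" "\<epsilon> < \<epsilon>\<^sub>0" by auto
    note entries = periodic_covariance_entries[OF elim(1)]
    have k: "q \<epsilon> t / m = a + \<epsilon> * Re (U / m * cis (\<omega> * t))" for t
      using pos by (simp add: q u a_def field_simps)
    \<comment> \<open>The mean noise is exactly what maintains the equilibrium value
      \<open>z0\<close>.\<close>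
    have n: "2 * \<gamma> * k\<^sub>B * T \<epsilon> t / m\<^sup>2 = 2 * g * z0 + \<epsilon> * b * cos (\<omega> * t)" for t
      using pos by (simp add: T g_def z0_def b_def field_simps power2_eq_square)
    note entries = entries[unfolded k n, folded g_def]
    have "\<bar>\<Sigma> \<epsilon> t $ 1 $ 1 - x0 - \<epsilon> * Re (xh * cis (\<omega> * t))\<bar> \<le> C * \<epsilon>\<^sup>2 \<and>
      \<bar>\<Sigma> \<epsilon> t $ 2 $ 2 - z0 - \<epsilon> * Re (zh * cis (\<omega> * t))\<bar> \<le> C * \<epsilon>\<^sup>2" for t
    proof (rule response[OF \<epsilon>])
      show "((\<lambda>t. \<Sigma> \<epsilon> t $ 1 $ 2) has_real_derivative
         \<Sigma> \<epsilon> t $ 2 $ 2 - (a + \<epsilon> * Re (U / m * cis (\<omega> * t))) * \<Sigma> \<epsilon> t $ 1 $ 1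
           - g * \<Sigma> \<epsilon> t $ 1 $ 2) (at t)" for t
        by (rule entries(3))
      show "((\<lambda>t. \<Sigma> \<epsilon> t $ 2 $ 2) has_real_derivative
         - 2 * (a + \<epsilon> * Re (U / m * cis (\<omega> * t))) * \<Sigma> \<epsilon> t $ 1 $ 2 - 2 * g * \<Sigma> \<epsilon> t $ 2 $ 2
           + 2 * g * z0 + \<epsilon> * b * cos (\<omega> * t)) (at t)" for t
        using entries(4)[of t] by (simp only: add.assoc)
    qed (simp_all only: entries(1), rule entries(2))
    moreover have "continuous_on UNIV (\<lambda>t. \<Sigma> \<epsilon> t $ 1 $ 1)" "continuous_on UNIV (\<lambda>t. \<Sigma> \<epsilon> t $ 2 $ 2)"
      by (rule DERIV_continuous_on[OF has_field_derivative_at_within], rule entries(2,4))+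
    ultimately show ?case using \<epsilon> by blast
  qed

  have p: "2 * pi / \<omega> \<ge> 0" using pos by simp
  define Q1 where "Q1 = 2 * \<kappa> * \<gamma> * k\<^sub>B * T\<^sub>1 / (m * \<omega>)"
  have "Q1 > 0" using pos \<open>\<kappa> > 0\<close> by (simp add: Q1_def)
  have Q: "(\<lambda>\<epsilon>. heat_intake m \<gamma> k\<^sub>B \<omega> (T \<epsilon>) (\<Sigma> \<epsilon>) - \<epsilon> * Q1) \<in> O[at_right 0](\<lambda>\<epsilon>. \<epsilon>\<^sup>2)"
  proof (rule bigoI)
    from expansion show "\<forall>\<^sub>F \<epsilon> in at_right 0. norm (heat_intake m \<gamma> k\<^sub>B \<omega> (T \<epsilon>) (\<Sigma> \<epsilon>) - \<epsilon> * Q1)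
        \<le> (\<gamma> * C * (2 * pi / \<omega>)) * norm (\<epsilon>\<^sup>2)"
    proof eventually_elim
      case (elim \<epsilon>)
      let ?f = "\<lambda>t. \<gamma> * (k\<^sub>B / m * T \<epsilon> t - \<Sigma> \<epsilon> t $ 2 $ 2)"
      let ?h = "\<lambda>t. Re (of_real (\<epsilon> * \<gamma>) * H * cis (\<omega> * t))"
      have "((\<lambda>t. max 0 (?h t)) has_integral 2 * cmod (of_real (\<epsilon> * \<gamma>) * H) / \<omega>) {0..2 * pi / \<omega>}"
        by (rule has_integral_max_Re_mult_cis[OF pos(4)])
      also have "2 * cmod (of_real (\<epsilon> * \<gamma>) * H) / \<omega> = \<epsilon> * Q1"
        using elim pos by (simp add: norm_mult cmod_H Q1_def)
      finally have I: "((\<lambda>t. max 0 (?h t)) has_integral \<epsilon> * Q1) {0..2 * pi / \<omega>}" .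
      have "continuous_on UNIV (\<lambda>t. \<Sigma> \<epsilon> t $ 2 $ 2)" using elim by blast
      hence "continuous_on UNIV (\<lambda>t. max 0 (?f t))"
        unfolding T
        by (intro continuous_on_max continuous_on_const continuous_on_mult continuous_on_diff
            continuous_on_add continuous_on_cos continuous_on_id)
      moreover have "\<bar>max 0 (?f t) - max 0 (?h t)\<bar> \<le> \<gamma> * C * \<epsilon>\<^sup>2" for t
      proof -
        \<comment> \<open>The constant parts cancel because \<open>z0\<close> is the equipartition
          value, so the heat rate starts at first order.\<close>
        have "?f t - ?h t = - \<gamma> * (\<Sigma> \<epsilon> t $ 2 $ 2 - z0 - \<epsilon> * Re (zh * cis (\<omega> * t)))"
          using pos by (simp add: T H_def z0_def algebra_simps add_divide_distrib)
        hence "\<bar>?f t - ?h t\<bar> = \<gamma> * \<bar>\<Sigma> \<epsilon> t $ 2 $ 2 - z0 - \<epsilon> * Re (zh * cis (\<omega> * t))\<bar>"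
          using pos by (simp add: abs_mult)
        also have "\<dots> \<le> \<gamma> * (C * \<epsilon>\<^sup>2)" using elim pos by (intro mult_left_mono) auto
        finally have "\<bar>?f t - ?h t\<bar> \<le> \<gamma> * C * \<epsilon>\<^sup>2" by simp
        \<comment> \<open>The positive part is 1-Lipschitz, so sign changes of the heat rate cost
          nothing in the error.\<close>
        moreover have "\<bar>max 0 v - max 0 w\<bar> \<le> \<bar>v - w\<bar>" for v w :: real by linarith
        ultimately show ?thesis by (rule order_trans[rotated])
      qed
      ultimately have "\<bar>integral {0..2 * pi / \<omega>} (\<lambda>t. max 0 (?f t)) - \<epsilon> * Q1\<bar> \<le> \<gamma> * C * \<epsilon>\<^sup>2 * (2 * pi / \<omega>)"
        by (rule integral_approx[OF _ I _ p])
      thus ?case by (simp add: heat_intake_def mult_ac)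
    qed
  qed

  define W2 where "W2 = pi * c * k\<^sub>B * \<gamma> * T\<^sub>1"
  have W: "(\<lambda>\<epsilon>. cycle_work \<omega> (q \<epsilon>) (\<Sigma> \<epsilon>) - W2 * \<epsilon>\<^sup>2) \<in> O[at_right 0](\<lambda>\<epsilon>. \<epsilon> ^ 3)"
  proof (rule bigoI)
    from expansion show "\<forall>\<^sub>F \<epsilon> in at_right 0. norm (cycle_work \<omega> (q \<epsilon>) (\<Sigma> \<epsilon>) - W2 * \<epsilon>\<^sup>2)
        \<le> (cmod (\<i> * \<omega> * U) * C * pi / \<omega>) * norm (\<epsilon> ^ 3)"
    proof eventually_elim
      case (elim \<epsilon>)
      let ?v = "\<lambda>t. Re (\<i> * \<omega> * U * cis (\<omega> * t))" and ?x = "\<lambda>t. Re (xh * cis (\<omega> * t))"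
      have "(q \<epsilon> has_real_derivative \<epsilon> * ?v t) (at t)" for t
      proof -
        have "((\<lambda>t. q\<^sub>0 + \<epsilon> * Re (U * cis (\<omega> * t))) has_real_derivative 0 + \<epsilon> * ?v t) (at t)"
          by (intro DERIV_add DERIV_cmult has_real_derivative_Re_mult_cis) simp
        moreover have "q \<epsilon> = (\<lambda>t. q\<^sub>0 + \<epsilon> * Re (U * cis (\<omega> * t)))" by (rule ext) (simp only: q u)
        ultimately show ?thesis by simp
      qed
      hence dq: "deriv (q \<epsilon>) t = \<epsilon> * ?v t" for t by (rule DERIV_imp_deriv)
      \<comment> \<open>The equilibrium value \<open>x0\<close> multiplies a pure harmonic and
        yields no work; the second-order term is the mean of the product of two harmonics.\<close>
      have "((\<lambda>t. \<epsilon> * x0 * ?v t + \<epsilon>\<^sup>2 * (?v t * ?x t)) has_integral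
          \<epsilon> * x0 * 0 + \<epsilon>\<^sup>2 * (pi / \<omega> * Re (\<i> * \<omega> * U * cnj xh))) {0..2 * pi / \<omega>}"
        using pos p
        by (intro has_integral_add has_integral_mult_right has_integral_Re_mult_Re_cis
            has_integral_Re_mult_cis_zero) (auto simp: complex_eq_iff)
      also have "\<epsilon> * x0 * 0 + \<epsilon>\<^sup>2 * (pi / \<omega> * Re (\<i> * \<omega> * U * cnj xh)) = - 2 * W2 * \<epsilon>\<^sup>2"
      proof -
        have "Re (\<i> * \<omega> * U * cnj xh) = - \<omega> * Im (c * Complex \<beta> \<alpha> * cnj xh)"
          by (simp add: U_def algebra_simps)
        thus ?thesis using pos by (simp only: power) (simp add: W2_def)
      qed
      finally have I: "((\<lambda>t. \<epsilon> * x0 * ?v t + \<epsilon>\<^sup>2 * (?v t * ?x t)) has_integral - 2 * W2 * \<epsilon>\<^sup>2) {0..2 * pi / \<omega>}" .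
      have "continuous_on UNIV (\<lambda>t. \<epsilon> * ?v t * \<Sigma> \<epsilon> t $ 1 $ 1)"
        by (intro continuous_on_mult continuous_on_const continuous_on_Re continuous_on_cis
            continuous_on_id) (use elim in blast)
      moreover have "\<bar>\<epsilon> * ?v t * \<Sigma> \<epsilon> t $ 1 $ 1 - (\<epsilon> * x0 * ?v t + \<epsilon>\<^sup>2 * (?v t * ?x t))\<bar>
          \<le> \<epsilon> * cmod (\<i> * \<omega> * U) * (C * \<epsilon>\<^sup>2)" for t
      proof -
        \<comment> \<open>The derivative of the stiffness has a factor \<epsilon>, which raises the
          quadratic error of the covariance to third order.\<close>
        have "\<epsilon> * ?v t * \<Sigma> \<epsilon> t $ 1 $ 1 - (\<epsilon> * x0 * ?v t + \<epsilon>\<^sup>2 * (?v t * ?x t))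
            = \<epsilon> * ?v t * (\<Sigma> \<epsilon> t $ 1 $ 1 - x0 - \<epsilon> * ?x t)"
          by (simp only: algebra_simps power2_eq_square)
        moreover have "\<bar>\<epsilon> * ?v t * (\<Sigma> \<epsilon> t $ 1 $ 1 - x0 - \<epsilon> * ?x t)\<bar> \<le> \<epsilon> * cmod (\<i> * \<omega> * U) * (C * \<epsilon>\<^sup>2)"
          unfolding abs_mult using elim abs_Re_mult_cis_le[of "\<i> * \<omega> * U" "\<omega> * t"]
          by (intro mult_mono) auto
        ultimately show ?thesis by simp
      qed
      ultimately have "\<bar>integral {0..2 * pi / \<omega>} (\<lambda>t. \<epsilon> * ?v t * \<Sigma> \<epsilon> t $ 1 $ 1) - - 2 * W2 * \<epsilon>\<^sup>2\<bar>
          \<le> \<epsilon> * cmod (\<i> * \<omega> * U) * (C * \<epsilon>\<^sup>2) * (2 * pi / \<omega>)"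
        by (rule integral_approx[OF _ I _ p])
      also have "\<dots> = 2 * ((cmod (\<i> * \<omega> * U) * C * pi / \<omega>) * \<epsilon> ^ 3)"
        by (simp only: power2_eq_square power3_eq_cube) simp
      finally have "\<bar>cycle_work \<omega> (q \<epsilon>) (\<Sigma> \<epsilon>) - W2 * \<epsilon>\<^sup>2\<bar> \<le> (cmod (\<i> * \<omega> * U) * C * pi / \<omega>) * \<epsilon> ^ 3"
        unfolding cycle_work_def dq by linarith
      thus ?case using elim by simp
    qed
  qed

  have ratio: "W2 / Q1 = pi * m * \<omega> * q\<^sub>0 * \<gamma> * T\<^sub>1 / (2 * \<kappa> * T\<^sub>0 * (2 * \<gamma> * \<beta> - \<alpha> * \<omega> * m))"
    unfolding W2_def Q1_def c_def d_def[symmetric] using pos \<open>d > 0\<close> \<open>\<kappa> > 0\<close>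
    by (simp add: field_simps)
  show ?thesis
    using Q quotient_bigo[OF W Q \<open>Q1 > 0\<close>] unfolding ratio efficiency_def unfolding Q1_def by blast
qed

end
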